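(* Let $N\ge3$ and let $A\ne\mathrm{Id}$ be a diagonal matrix $A=\mathrm{diag}(a_1,\dots,a_N)$ with $1=a_1\le a_2\le\dots\le a_N$. Then $0<\nu_{A,N}<2$, where $$\nu_{A,N}:=\inf\left\{a_N^{-\frac N2}\gamma(\lambda(A,u))+\gamma(\lambda(\mathrm{Id},v)):\ u,v\in H^1(\mathbb{S}^{N-1}),\ \int_{\mathbb{S}^{N-1}}u^2v^2=0\right\}.$$
   Context: On $\mathbb{S}^{N-1}$ let $\nu=\nu(\xi)=\xi$ be the outer unit normal and $\mu(\xi)=\langle A\xi,\xi\rangle$. Let $\nabla_\theta^A\varphi:=\nabla\varphi-\frac{\langle A\nabla\varphi,\nu\rangle}{\langle A\nu,\nu\rangle}\nu$ (this depends only on the tangential part of $\nabla\varphi$). For $u\in H^1(\mathbb{S}^{N-1})$, $$\lambda(A,u):=\inf\left\{\frac{\int_{\mathbb{S}^{N-1}}\langle A\nabla_\theta^A\varphi,\nabla_\theta^A\varphi\rangle\,d\sigma}{\int_{\mathbb{S}^{N-1}}\varphi^2\mu\,d\sigma}:\ \varphi\in H^1(\mathbb{S}^{N-1})\setminus\{0\},\ \mathcal{H}^{N-1}(\{\varphi\ne0\}\cap\{u=0\})=0\right\},$$ with the convention $\lambda(A,u)=+\infty$ if $u\equiv0$ on $\mathbb{S}^{N-1}$; $\lambda(\mathrm{Id},\cdot)$ is the same quantity with $A$ replaced by $\mathrm{Id}$. The function $\gamma:\mathbb{R}^+\to\mathbb{R}^+$ is $\gamma(t):=\sqrt{\left(\frac{N-2}{2}\right)^2+t}-\frac{N-2}{2}$,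 with $\gamma(+\infty)=+\infty$. *)

theory Defs
  imports "HOL-Analysis.Analysis"
begin

definition diag_matrix :: "('n \<Rightarrow> real) \<Rightarrow> real ^ 'n ^ 'n" where
  "diag_matrix a = (\<chi> i j. if i = j then a i else 0)"

(* The surface measure of the unit sphere, obtained from polar coordinates: the mass of
   a Borel set E is N times the volume of the cone {t x | 0 < t \<le> 1, x in E}.  On Borel
   subsets of the sphere it coincides with the (N-1)-dimensional Hausdorff measure.
   Its underlying space is the sphere, so a measurable function for it is a function
   whose restriction to the sphere is Borel; values off the sphere never matter. *)
definition sphere_measure :: "(real ^ 'n) measure" where
  "sphere_measure = scale_measure (of_nat CARD('n))
     (distr (restrict_space lborel (cball 0 1 - {0}))
            (restrict_space borel (sphere 0 1)) (\<lambda>x. x /\<^sub>R norm x))"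

lemma space_sphere_measure: "space sphere_measure = sphere 0 1"
  by (simp add: sphere_measure_def space_restrict_space space_scale_measure)

lemma sets_sphere_measure: "sets sphere_measure = sets (restrict_space borel (sphere 0 1))"
  by (simp add: sphere_measure_def)

lemma emeasure_sphere_measure:
  fixes E :: "(real ^ 'n) set"
  assumes "E \<in> sets borel" "E \<subseteq> sphere 0 1"
  shows "emeasure sphere_measure E =
           of_nat CARD('n) * emeasure lborel {x \<in> cball 0 1 - {0}. x /\<^sub>R norm x \<in> E}"
proof -
  let ?B = "cball 0 1 - {0} :: (real ^ 'n) set"
  let ?R = "restrict_space lborel ?B"
  have "(\<lambda>x :: real ^ 'n. x /\<^sub>R norm x) \<in> borel_measurable ?R"
    by (intro measurable_restrict_space1) measurable
  then have meas: "(\<lambda>x :: real ^ 'n. x /\<^sub>R norm x) \<in>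
      measurable ?R (restrict_space borel (sphere 0 1))"
    by (intro measurable_restrict_space2) (auto simp: space_restrict_space)
  have E: "E \<in> sets (restrict_space borel (sphere 0 1))"
    using assms by (auto simp: sets_restrict_space)
  have "emeasure sphere_measure E =
      of_nat CARD('n) * emeasure ?R ((\<lambda>x. x /\<^sub>R norm x) -` E \<inter> space ?R)"
    by (simp add: sphere_measure_def emeasure_distr[OF meas E])
  also have "(\<lambda>x. x /\<^sub>R norm x) -` E \<inter> space ?R = {x \<in> ?B. x /\<^sub>R norm x \<in> E}"
    by (auto simp: space_restrict_space)
  also have "emeasure ?R {x \<in> ?B. x /\<^sub>R norm x \<in> E} =
      emeasure lborel {x \<in> ?B. x /\<^sub>R norm x \<in> E}"
    by (intro emeasure_restrict_space) auto
  finally show ?thesis .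
qed

definition C1_with_gradient :: "(real ^ 'n \<Rightarrow> real) \<Rightarrow> (real ^ 'n \<Rightarrow> real ^ 'n) \<Rightarrow> bool" where
  "C1_with_gradient f F \<longleftrightarrow> (\<forall>x. GDERIV f x :> F x) \<and> continuous_on UNIV F"

definition tangential_part :: "real ^ 'n \<Rightarrow> real ^ 'n \<Rightarrow> real ^ 'n" where
  "tangential_part \<xi> w = w - (w \<bullet> \<xi>) *\<^sub>R \<xi>"

(* The Sobolev space on the sphere is the completion of the C^1 functions in the norm
   (|f|^2 + |grad f|^2)^(1/2), realised inside L^2: the function phi has gradient g if some
   sequence of C^1 functions converges to phi in L^2 while their tangential gradients
   converge to g in L^2.  Both are determined up to null sets only, and g is determined
   a.e. by phi (the tangential gradient is a closable operator).  Every C^1 function on the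
   sphere is the restriction of a C^1 function on the whole space.  The convergence forces
   phi and g to be square integrable. *)
definition has_sphere_gradient :: "(real ^ 'n \<Rightarrow> real) \<Rightarrow> (real ^ 'n \<Rightarrow> real ^ 'n) \<Rightarrow> bool" where
  "has_sphere_gradient \<phi> g \<longleftrightarrow>
     \<phi> \<in> borel_measurable sphere_measure \<and>
     g \<in> borel_measurable sphere_measure \<and>
     (\<exists>f F. (\<forall>k::nat. C1_with_gradient (f k) (F k)) \<and>
       (\<lambda>k. \<integral>\<^sup>+ \<xi>. ennreal ((f k \<xi> - \<phi> \<xi>)\<^sup>2) \<partial>sphere_measure) \<longlonglongrightarrow> 0 \<and>
       (\<lambda>k. \<integral>\<^sup>+ \<xi>. ennreal ((norm (tangential_part \<xi> (F k \<xi>) - g \<xi>))\<^sup>2) \<partial>sphere_measure)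
         \<longlonglongrightarrow> 0)"

definition H1_sphere :: "(real ^ 'n \<Rightarrow> real) set" where
  "H1_sphere = {\<phi>. \<exists>g. has_sphere_gradient \<phi> g}"

definition mu_weight :: "real ^ 'n ^ 'n \<Rightarrow> real ^ 'n \<Rightarrow> real" where
  "mu_weight A \<xi> = (A *v \<xi>) \<bullet> \<xi>"

(* The operator nabla_theta^A at the point xi, applied to a gradient vector w; the outer
   unit normal at xi is xi itself. *)
definition theta_gradient :: "real ^ 'n ^ 'n \<Rightarrow> real ^ 'n \<Rightarrow> real ^ 'n \<Rightarrow> real ^ 'n" where
  "theta_gradient A \<xi> w = w - (((A *v w) \<bullet> \<xi>) / ((A *v \<xi>) \<bullet> \<xi>)) *\<^sub>R \<xi>"

definition rayleigh_quotient ::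
  "real ^ 'n ^ 'n \<Rightarrow> (real ^ 'n \<Rightarrow> real) \<Rightarrow> (real ^ 'n \<Rightarrow> real ^ 'n) \<Rightarrow> real" where
  "rayleigh_quotient A \<phi> g =
     (\<integral>\<xi>. (A *v theta_gradient A \<xi> (g \<xi>)) \<bullet> theta_gradient A \<xi> (g \<xi>) \<partial>sphere_measure) /
     (\<integral>\<xi>. (\<phi> \<xi>)\<^sup>2 * mu_weight A \<xi> \<partial>sphere_measure)"

definition lambda_sphere :: "real ^ 'n ^ 'n \<Rightarrow> (real ^ 'n \<Rightarrow> real) \<Rightarrow> ereal" where
  "lambda_sphere A u =
     (if (AE \<xi> in sphere_measure. u \<xi> = 0) then \<infinity>
      else Inf {ereal (rayleigh_quotient A \<phi> g) | \<phi> g.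
             has_sphere_gradient \<phi> g \<and>
             \<not> (AE \<xi> in sphere_measure. \<phi> \<xi> = 0) \<and>
             {\<xi> \<in> sphere 0 1. \<phi> \<xi> \<noteq> 0 \<and> u \<xi> = 0} \<in> null_sets sphere_measure})"

(* The argument N is the dimension.  Only arguments in [0, \<infinity>] are relevant. *)
definition gamma_fun :: "nat \<Rightarrow> ereal \<Rightarrow> ereal" where
  "gamma_fun N t =
     (if t = \<infinity> then \<infinity>
      else ereal (sqrt (((real N - 2) / 2)\<^sup>2 + real_of_ereal t) - (real N - 2) / 2))"

(* Indices 1, ..., N are modelled by a finite linearly ordered index type, so that a_N is
   the value at the largest index.  The integral of u^2 v^2 is taken as a Lebesgue integral
   with values in [0, \<infinity>]: u^2 v^2 need not be integrable, and the Bochner integral of a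
   non-integrable function would be 0. *)
definition nu_AN :: "('n::{finite,linorder} \<Rightarrow> real) \<Rightarrow> ereal" where
  "nu_AN a = Inf {ereal (a (Max UNIV) powr (- (real CARD('n) / 2))) *
                    gamma_fun CARD('n) (lambda_sphere (diag_matrix a) u) +
                  gamma_fun CARD('n) (lambda_sphere (mat 1) v) | u v.
                  u \<in> H1_sphere \<and> v \<in> H1_sphere \<and>
                  (\<integral>\<^sup>+ \<xi>. ennreal ((u \<xi>)\<^sup>2 * (v \<xi>)\<^sup>2) \<partial>(sphere_measure :: (real ^ ('n::{finite,linorder})) measure))
                    = 0}"

end

theory Submission
  imports Defs
begin

text \<open>
  The upper bound comes from a pair of opposite half spheres. For a unit vector \<open>e = \<plusminus>e\<^sub>i\<close>
  with \<open>a\<^sub>i = 1\<close> the positive part of \<open>\<langle>e, \<xi>\<rangle>\<close> is an admissible test function for itself, and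
  for the identity matrix its Rayleigh quotient is at most \<open>N - 1\<close>, the value at which \<open>\<gamma>\<close>
  equals 1. For \<open>A\<close> the operator \<open>\<nabla>\<^sub>\<theta>\<^sup>A\<close> is the \<open>A\<close>-orthogonal projection along the
  normal, so it makes the energy density \<open>1 - \<langle>e, \<xi>\<rangle>\<^sup>2 / \<mu>\<close>, while \<open>1 \<le> \<mu> \<le> a\<^sub>N\<close>. Together with
  the second moment \<open>1 / N\<close> of a coordinate on the sphere this bounds the quotient by
  \<open>N - 1 / a\<^sub>N\<close> (\<open>rayleigh_quotient_pos_part_le\<close>). Put \<open>r = a\<^sub>N powr (N / 2)\<close>. Since \<open>r\<^sup>2 \<ge> a\<^sub>N\<close>
  and \<open>a\<^sub>N + 1 / a\<^sub>N > 2\<close>, the number \<open>N - 1 / a\<^sub>N\<close> is smaller than \<open>r\<^sup>2 + (N - 2) r\<close>, whose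
  image under \<open>\<gamma>\<close> is \<open>r\<close>. So the first summand is strictly below 1, the second is at most 1.

  The lower bound comes from a Poincare inequality. If \<open>u v = 0\<close> almost everywhere, then \<open>u\<close> or
  \<open>v\<close> vanishes on at least half of the sphere, and so does every test function for it. For a
  function \<open>\<phi>\<close> that vanishes on half of the sphere, the double integral of
  \<open>(\<phi> \<xi> - \<phi> \<eta>)\<^sup>2\<close> is at least half the total mass times the integral of \<open>\<phi>\<^sup>2\<close>. So a bound of
  this double integral by the Dirichlet energy (\<open>sphere_poincare\<close>) gives a positive lower bound
  for all Rayleigh quotients of \<open>\<phi>\<close>, with a constant that depends on \<open>N\<close> and \<open>a\<^sub>N\<close> only.

  The Poincare inequality is transported from the unit ball. A \<open>C\<^sup>1\<close> function \<open>f\<close> on the sphere is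
  extended by \<open>f (x / |x|)\<close>; the gradient of the extension is the tangential gradient of \<open>f\<close>
  divided by \<open>|x|\<close>. The ball is convex, so the difference of two values is the integral of the
  derivative over a segment, and an affine change of variables bounds the mean over all segments
  by an integral over the ball. The singular weight \<open>|x|\<^sup>-\<^sup>2\<close> is integrable because \<open>N \<ge> 3\<close>
  (\<open>nn_integral_radial_weight\<close>).
\<close>

section \<open>Integration over the sphere\<close>

lemma borel_measurable_sphere_measureI:
  "f \<in> borel_measurable borel \<Longrightarrow> f \<in> borel_measurable sphere_measure"
  using measurable_cong_sets[OF sets_sphere_measure refl] measurable_restrict_space1 by blast

text \<open>
  The surface measure is defined through cones. In the form of polar coordinates this says that
  integrals over the sphere are Lebesgue integrals of functions that are homogeneous of degree
  zero, and all properties of the surface measure are obtained from those of Lebesgue measure in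
  this way.
\<close>

lemma nn_integral_sphere_measure:
  fixes k :: "real ^ 'n \<Rightarrow> ennreal"
  assumes k [measurable]: "k \<in> borel_measurable borel"
  shows "(\<integral>\<^sup>+ \<xi>. k \<xi> \<partial>sphere_measure) =
    of_nat CARD('n) * (\<integral>\<^sup>+ x. k (sgn x) * indicator (cball 0 1) x \<partial>lborel)"
proof -
  let ?B = "cball 0 1 - {0} :: (real ^ 'n) set"
  let ?R = "restrict_space lborel ?B"
  have "(\<lambda>x :: real ^ 'n. x /\<^sub>R norm x) \<in> borel_measurable ?R"
    by (intro measurable_restrict_space1) measurable
  then have meas: "(\<lambda>x :: real ^ 'n. x /\<^sub>R norm x) \<in>
      measurable ?R (restrict_space borel (sphere 0 1))"
    by (intro measurable_restrict_space2) (auto simp: space_restrict_space)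
  have k': "k \<in> borel_measurable (restrict_space borel (sphere 0 1))"
    by (intro measurable_restrict_space1) measurable
  have "(\<integral>\<^sup>+ \<xi>. k \<xi> \<partial>sphere_measure) = of_nat CARD('n) * (\<integral>\<^sup>+ x. k (x /\<^sub>R norm x) \<partial>?R)"
    using k' by (simp add: sphere_measure_def nn_integral_scale_measure nn_integral_distr[OF meas])
  also have "(\<integral>\<^sup>+ x. k (x /\<^sub>R norm x) \<partial>?R) = (\<integral>\<^sup>+ x. k (sgn x) * indicator ?B x \<partial>lborel)"
    by (subst nn_integral_restrict_space) (simp_all add: sgn_div_norm)
  also have "\<dots> = (\<integral>\<^sup>+ x. k (sgn x) * indicator (cball 0 1) x \<partial>lborel)"
    using AE_lborel_singleton[of "0 :: real ^ 'n"]
    by (intro nn_integral_cong_AE) (elim eventually_mono, auto simp: indicator_def)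
  finally show ?thesis .
qed

text \<open>
  The type argument carries the dimension.
\<close>

abbreviation sphere_mass :: "'n::finite itself \<Rightarrow> ennreal" where
  "sphere_mass _ \<equiv> emeasure (sphere_measure :: (real ^ 'n) measure) (sphere 0 1)"

lemma sphere_mass_eq:
  "sphere_mass TYPE('n) = of_nat CARD('n) * emeasure lborel (cball 0 1 :: (real ^ 'n) set)"
proof -
  have "sphere_mass TYPE('n) = (\<integral>\<^sup>+ \<xi>. 1 \<partial>(sphere_measure :: (real ^ 'n) measure))"
    by (simp add: space_sphere_measure)
  also have "\<dots> = of_nat CARD('n) * emeasure lborel (cball 0 1 :: (real ^ 'n) set)"
    by (subst nn_integral_sphere_measure) auto
  finally show ?thesis .
qed

lemma sphere_mass_pos: "sphere_mass TYPE('n::finite) > 0"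
proof -
  have "emeasure lborel (ball 0 1 :: (real ^ 'n) set) > 0"
    using content_ball_pos[of 1 "0 :: real ^ 'n"]
    by (metis enn2real_0 measure_def order_less_irrefl zero_less_iff_neq_zero zero_less_one)
  moreover have "\<dots> \<le> emeasure lborel (cball 0 1 :: (real ^ 'n) set)"
    by (intro emeasure_mono) auto
  ultimately show ?thesis
    by (auto simp: sphere_mass_eq ennreal_zero_less_mult_iff)
qed

lemma finite_measure_sphere_measure [simp, intro]:
  "finite_measure (sphere_measure :: (real ^ 'n) measure)"
proof
  have "emeasure lborel (cball 0 1 :: (real ^ 'n) set) < \<infinity>"
    by (intro emeasure_lborel_cball_finite)
  then show "emeasure sphere_measure (space (sphere_measure :: (real ^ 'n) measure)) \<noteq> \<infinity>"
    by (simp add: space_sphere_measure sphere_mass_eq ennreal_mult_eq_top_iff less_top)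
qed

lemma sphere_mass_finite: "sphere_mass TYPE('n::finite) \<noteq> top"
  by (rule finite_measure.emeasure_finite[OF finite_measure_sphere_measure])

lemma measure_sphere_pos: "0 < measure (sphere_measure :: (real ^ 'n) measure) (sphere 0 1)"
  using sphere_mass_pos[where 'n='n] sphere_mass_finite[where 'n='n]
  unfolding measure_def enn2real_positive_iff less_top by blast

lemma nn_integral_sphere_measure_uminus:
  fixes k :: "real ^ 'n \<Rightarrow> ennreal"
  assumes [measurable]: "k \<in> borel_measurable borel"
  shows "(\<integral>\<^sup>+ \<xi>. k (- \<xi>) \<partial>sphere_measure) = (\<integral>\<^sup>+ \<xi>. k \<xi> \<partial>sphere_measure)"
proof -
  have "(\<integral>\<^sup>+ x. k (sgn x) * indicator (cball 0 1) x \<partial>lborel) =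
    (\<integral>\<^sup>+ x. k (- sgn x) * indicator (cball 0 1) x \<partial>lborel)"
    by (subst lborel_affine[of "-1" 0])
       (simp_all add: nn_integral_density nn_integral_distr sgn_minus indicator_def)
  then show ?thesis
    by (simp add: nn_integral_sphere_measure)
qed

text \<open>
  Of the rotation invariance of the surface measure, only permutations of the coordinates and the
  antipodal map are used. For these, invariance of Lebesgue measure can be read off from the
  volumes of boxes.
\<close>

lemma lborel_distr_permute_coordinates:
  fixes p :: "'n::finite \<Rightarrow> 'n"
  assumes p: "bij p"
  shows "distr lborel borel (\<lambda>x :: real ^ 'n. \<chi> k. x $ p k) = lborel"
proof (rule lborel_eqI[symmetric])
  let ?T = "\<lambda>x :: real ^ 'n. \<chi> k. x $ p k"
  let ?S = "\<lambda>x :: real ^ 'n. \<chi> k. x $ inv p k"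
  have T [measurable]: "?T \<in> borel_measurable borel"
    by (intro borel_measurable_continuous_onI continuous_intros)
  have prodB: "(\<Prod>b\<in>Basis. f b) = (\<Prod>k\<in>UNIV. f (axis k 1))" for f :: "real ^ 'n \<Rightarrow> real"
  proof -
    have "Basis = range (\<lambda>k::'n. axis k (1::real))" "inj (\<lambda>k::'n. axis k (1::real))"
      by (auto simp: Basis_vec_def inj_on_def axis_eq_axis)
    then show ?thesis by (intro prod.reindex_cong) auto
  qed
  fix l u :: "real ^ 'n"
  assume lu: "\<And>b. b \<in> Basis \<Longrightarrow> l \<bullet> b \<le> u \<bullet> b"
  have lu': "l $ k \<le> u $ k" for k
    using lu[of "axis k 1"] by (simp add: inner_axis axis_in_Basis_iff)
  have pre: "?T -` box l u = box (?S l) (?S u)"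
  proof -
    have "(\<forall>k. l $ k < x $ p k \<and> x $ p k < u $ k) \<longleftrightarrow>
        (\<forall>k. l $ inv p k < x $ k \<and> x $ k < u $ inv p k)" (is "(\<forall>k. ?Q k) \<longleftrightarrow> _") for x
    proof -
      have "(\<forall>k. ?Q k) \<longleftrightarrow> (\<forall>k. ?Q (inv p k))"
        using bij_is_surj[OF bij_imp_bij_inv[OF p]] by (metis surjD)
      then show ?thesis
        using surj_f_inv_f[OF bij_is_surj[OF p]] by simp
    qed
    then show ?thesis by (auto simp: mem_box_cart)
  qed
  have "emeasure (distr lborel borel ?T) (box l u) = emeasure lborel (box (?S l) (?S u))"
    by (subst emeasure_distr) (simp_all add: pre)
  also have "\<dots> = (\<Prod>b\<in>Basis. (?S u - ?S l) \<bullet> b)"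
    by (subst emeasure_lborel_box) (auto simp: Basis_vec_def inner_axis lu')
  also have "(\<Prod>b\<in>Basis. (?S u - ?S l) \<bullet> b) = (\<Prod>k\<in>UNIV. (u - l) $ inv p k)"
    by (simp add: prodB inner_axis)
  also have "\<dots> = (\<Prod>k\<in>UNIV. (u - l) $ k)"
    using prod.reindex_bij_betw[OF bij_imp_bij_inv[OF p], of "\<lambda>k. (u - l) $ k"] by simp
  also have "\<dots> = (\<Prod>b\<in>Basis. (u - l) \<bullet> b)"
    by (simp add: prodB inner_axis)
  finally show "emeasure (distr lborel borel ?T) (box l u) = (\<Prod>b\<in>Basis. (u - l) \<bullet> b)" .
qed simp

lemma nn_integral_sphere_measure_permute_coordinates:
  fixes k :: "real ^ 'n \<Rightarrow> ennreal" and p :: "'n \<Rightarrow> 'n"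
  assumes [measurable]: "k \<in> borel_measurable borel" and p: "bij p"
  shows "(\<integral>\<^sup>+ \<xi>. k (\<chi> i. \<xi> $ p i) \<partial>sphere_measure) = (\<integral>\<^sup>+ \<xi>. k \<xi> \<partial>sphere_measure)"
proof -
  let ?T = "\<lambda>x :: real ^ 'n. \<chi> k. x $ p k"
  have T [measurable]: "?T \<in> borel_measurable borel"
    by (intro borel_measurable_continuous_onI continuous_intros)
  have norm: "norm (?T x) = norm x" for x
    using sum.reindex_bij_betw[OF p, of "\<lambda>i. (x $ i)\<^sup>2"] by (simp add: norm_vec_def L2_set_def)
  have sgn: "sgn (?T x) = ?T (sgn x)" for x
    by (simp add: sgn_div_norm norm vec_eq_iff)
  have "(\<integral>\<^sup>+ x. k (sgn x) * indicator (cball 0 1) x \<partial>lborel) =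
    (\<integral>\<^sup>+ x. k (sgn x) * indicator (cball 0 1) x \<partial>distr lborel borel ?T)"
    by (simp add: lborel_distr_permute_coordinates[OF p])
  also have "\<dots> = (\<integral>\<^sup>+ x. k (?T (sgn x)) * indicator (cball 0 1) x \<partial>lborel)"
    by (subst nn_integral_distr) (auto simp: sgn norm indicator_def)
  finally show ?thesis
    by (simp add: nn_integral_sphere_measure)
qed

text \<open>
  By symmetry the \<open>N\<close> second moments are equal, and the squares of the coordinates add up to 1.
\<close>

lemma nn_integral_sphere_coordinate_squared:
  fixes i :: "'n::finite"
  shows "of_nat CARD('n) * (\<integral>\<^sup>+ \<xi>. ennreal ((\<xi> $ i)\<^sup>2) \<partial>(sphere_measure :: (real ^ 'n) measure))
    = sphere_mass TYPE('n)"
proof -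
  let ?I = "\<lambda>j. \<integral>\<^sup>+ \<xi>. ennreal ((\<xi> $ j)\<^sup>2) \<partial>(sphere_measure :: (real ^ 'n) measure)"
  have eq: "?I j = ?I i" for j
  proof -
    have "(\<lambda>\<xi> :: real ^ 'n. ennreal ((\<xi> $ i)\<^sup>2)) \<in> borel_measurable borel"
      by measurable
    from nn_integral_sphere_measure_permute_coordinates[OF this bij_transpose, of i j]
    show ?thesis by (simp add: transpose_apply_first)
  qed
  have [measurable]: "(\<lambda>\<xi>. \<xi> $ j) \<in> borel_measurable (sphere_measure :: (real ^ 'n) measure)" for j
    by (intro borel_measurable_sphere_measureI) measurable
  have "of_nat CARD('n) * ?I i = (\<Sum>j\<in>(UNIV :: 'n set). ?I i)"
    by simp
  also have "\<dots> = (\<Sum>j\<in>UNIV. ?I j)"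
    by (intro sum.cong eq[symmetric] refl)
  also have "\<dots> = (\<integral>\<^sup>+ \<xi>. (\<Sum>j\<in>UNIV. ennreal ((\<xi> $ j)\<^sup>2)) \<partial>(sphere_measure :: (real ^ 'n) measure))"
    by (subst nn_integral_sum) simp_all
  also have "\<dots> = (\<integral>\<^sup>+ \<xi>. 1 \<partial>(sphere_measure :: (real ^ 'n) measure))"
  proof (intro nn_integral_cong)
    fix \<xi> :: "real ^ 'n" assume "\<xi> \<in> space sphere_measure"
    then have "norm \<xi> = 1" by (simp add: space_sphere_measure)
    then have "(\<Sum>j\<in>UNIV. (\<xi> $ j)\<^sup>2) = 1" by (simp add: norm_vec_def L2_set_def)
    then show "(\<Sum>j\<in>UNIV. ennreal ((\<xi> $ j)\<^sup>2)) = 1"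
      by (simp add: sum_ennreal)
  qed
  finally show ?thesis by (simp add: space_sphere_measure)
qed

section \<open>The Poincare inequality on the sphere\<close>

lemma cball_in_sets_borel [measurable]: "cball (c :: 'a::euclidean_space) r \<in> sets borel"
  by simp

lemma nn_integral_lborel_affine:
  fixes h :: "'a::euclidean_space \<Rightarrow> ennreal"
  assumes [measurable]: "h \<in> borel_measurable borel" and c: "c > 0"
  shows "(\<integral>\<^sup>+ x. h (w + c *\<^sub>R x) \<partial>lborel) = ennreal ((1 / c) ^ DIM('a)) * (\<integral>\<^sup>+ x. h x \<partial>lborel)"
proof -
  have "(\<integral>\<^sup>+ x. h x \<partial>lborel) = ennreal (c ^ DIM('a)) * (\<integral>\<^sup>+ x. h (w + c *\<^sub>R x) \<partial>lborel)"
    using c by (subst lborel_affine[of c w])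
       (simp_all add: nn_integral_density nn_integral_distr nn_integral_cmult)
  then show ?thesis
    using c by (simp add: mult.assoc[symmetric] ennreal_mult[symmetric] power_mult_distrib[symmetric])
qed

text \<open>
  For \<open>2\<^sup>-\<^sup>j\<^sup>-\<^sup>1 < |z| \<le> 2\<^sup>-\<^sup>j\<close> the weight is at most \<open>4\<^sup>j\<^sup>+\<^sup>1\<close>. The ball of radius \<open>2\<^sup>-\<^sup>j\<close>
  contributes \<open>2\<^sup>-\<^sup>j\<^sup>N\<close> times the integral over the unit ball, since \<open>k (sgn z)\<close> is invariant under
  scaling. For \<open>N \<ge> 3\<close> the resulting series is dominated by the sum of the numbers
  \<open>4\<^sup>j\<^sup>+\<^sup>1 8\<^sup>-\<^sup>j\<close>, which is 8.
\<close>

lemma nn_integral_radial_weight: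
  fixes k :: "'a::euclidean_space \<Rightarrow> ennreal"
  assumes [measurable]: "k \<in> borel_measurable borel" and dim: "DIM('a) \<ge> 3"
  shows "(\<integral>\<^sup>+ z. k (sgn z) * ennreal (1 / (norm z)\<^sup>2) * indicator (cball 0 1) z \<partial>lborel)
    \<le> 8 * (\<integral>\<^sup>+ z. k (sgn z) * indicator (cball 0 1) z \<partial>lborel)"
proof -
  define J where "J = (\<integral>\<^sup>+ z. k (sgn z) * indicator (cball 0 1) z \<partial>lborel)"
  define b where "b = (\<lambda>(j::nat) z :: 'a. ennreal (4 ^ (j + 1)) * (k (sgn z) * indicator (cball 0 1) (2 ^ j *\<^sub>R z)))"
  have b_meas [measurable]: "b j \<in> borel_measurable borel" for j
    unfolding b_def by measurable
  have int_b: "integral\<^sup>N lborel (b j) \<le> ennreal (4 * (1 / 2) ^ j) * J" for j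
  proof -
    have "integral\<^sup>N lborel (b j) =
        ennreal (4 ^ (j + 1)) * (\<integral>\<^sup>+ z. k (sgn (0 + 2 ^ j *\<^sub>R z)) * indicator (cball 0 1) (0 + 2 ^ j *\<^sub>R z) \<partial>lborel)"
      by (simp add: b_def nn_integral_cmult sgn_scaleR)
    also have "\<dots> = ennreal (4 ^ (j + 1)) * (ennreal ((1 / 2 ^ j) ^ DIM('a)) * J)"
      unfolding J_def by (subst nn_integral_lborel_affine) simp_all
    also have "\<dots> = ennreal (4 ^ (j + 1) * (1 / 2 ^ j) ^ DIM('a)) * J"
      by (simp add: ennreal_mult mult.assoc)
    also have "\<dots> \<le> ennreal (4 * (1 / 2) ^ j) * J"
    proof (intro mult_right_mono ennreal_leI)
      have "(1 / 2 ^ j :: real) ^ DIM('a) \<le> (1 / 2 ^ j) ^ 3"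
        using dim by (intro power_decreasing) auto
      then have "4 ^ (j + 1) * (1 / 2 ^ j) ^ DIM('a) \<le> 4 ^ (j + 1) * (1 / 2 ^ j :: real) ^ 3"
        by (intro mult_left_mono) auto
      also have "\<dots> = 4 * (1 / 2) ^ j"
      proof -
        have "(4 :: real) ^ j = (2\<^sup>2) ^ j" by simp
        also have "\<dots> = (2 ^ j)\<^sup>2" by (simp only: power_mult[symmetric] mult.commute)
        finally show ?thesis by (simp add: power_divide power2_eq_square power3_eq_cube)
      qed
      finally show "4 ^ (j + 1) * (1 / 2 ^ j) ^ DIM('a) \<le> 4 * (1 / 2 :: real) ^ j" .
    qed simp
    finally show ?thesis .
  qed
  have pointwise: "k (sgn z) * ennreal (1 / (norm z)\<^sup>2) * indicator (cball 0 1) z \<le> (\<Sum>j. b j z)" for z :: 'a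
  proof (cases "z \<noteq> 0 \<and> norm z \<le> 1")
    case True
    then obtain n where n: "(1 / 2) ^ n < norm z"
      using real_arch_pow_inv[of "norm z" "1 / 2"] by auto
    \<comment> \<open>The index of the dyadic shell that contains z.\<close>
    define j where "j = (LEAST n. (1 / 2) ^ Suc n < norm z)"
    have ex: "\<exists>n. (1 / 2) ^ Suc n < norm z"
      using n norm_ge_zero[of z] by (intro exI[of _ n], unfold power_Suc, linarith)
    have j1: "(1 / 2) ^ Suc j < norm z"
      unfolding j_def using ex by (rule LeastI_ex)
    have j2: "norm z \<le> (1 / 2) ^ j"
    proof (cases j)
      case 0 then show ?thesis using True by simp
    next
      case (Suc i)
      then show ?thesis using not_less_Least[of i "\<lambda>n. (1 / 2) ^ Suc n < norm z"] by (auto simp: j_def)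
    qed
    have "1 / (norm z)\<^sup>2 \<le> 1 / ((1 / 2) ^ Suc j)\<^sup>2"
      using j1 by (intro divide_left_mono power_mono mult_pos_pos zero_less_power) auto
    also have "\<dots> = 4 ^ (j + 1)"
    proof -
      have "(4 :: real) ^ (j + 1) = (2\<^sup>2) ^ (Suc j)" by simp
      also have "\<dots> = (2 ^ Suc j)\<^sup>2" by (simp only: power_mult[symmetric] mult.commute)
      finally show ?thesis by (simp add: power_divide)
    qed
    finally have "1 / (norm z)\<^sup>2 \<le> 4 ^ (j + 1)" .
    moreover have "norm (2 ^ j *\<^sub>R z) \<le> 1"
      using j2 by (simp add: power_divide field_simps)
    ultimately have "k (sgn z) * ennreal (1 / (norm z)\<^sup>2) * indicator (cball 0 1) z \<le> b j z"
      using True by (simp add: b_def mult.commute[of "k _"] mult_right_mono ennreal_leI)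
    also have "\<dots> \<le> (\<Sum>j. b j z)"
      using sum_le_suminf[of "\<lambda>j. b j z" "{j}"] by simp
    finally show ?thesis .
  qed (auto simp: indicator_def)
  have "(\<integral>\<^sup>+ z. k (sgn z) * ennreal (1 / (norm z)\<^sup>2) * indicator (cball 0 1) z \<partial>lborel)
      \<le> (\<integral>\<^sup>+ z. (\<Sum>j. b j z) \<partial>lborel)"
    by (intro nn_integral_mono pointwise)
  also have "\<dots> = (\<Sum>j. integral\<^sup>N lborel (b j))"
    by (intro nn_integral_suminf) measurable
  also have "\<dots> \<le> (\<Sum>j. ennreal (4 * (1 / 2) ^ j) * J)"
    by (intro suminf_le int_b) auto
  also have "\<dots> = (\<Sum>j. ennreal (4 * (1 / 2) ^ j)) * J"
    by simp
  also have "(\<Sum>j. ennreal (4 * (1 / 2) ^ j)) = ennreal (\<Sum>j. 4 * (1 / 2) ^ j)"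
    by (intro suminf_ennreal2) (auto intro!: summable_mult summable_geometric)
  also have "(\<Sum>j. 4 * (1 / 2) ^ j :: real) = 8"
    using suminf_mult[of "\<lambda>j. (1 / 2 :: real) ^ j" 4] suminf_geometric[of "1 / 2 :: real"]
    by (simp add: summable_geometric)
  finally show ?thesis by (simp add: J_def)
qed

lemma norm_tangential_part_le: "norm \<xi> = 1 \<Longrightarrow> norm (tangential_part \<xi> w) \<le> norm w"
proof -
  assume "norm \<xi> = 1"
  then have "(norm (tangential_part \<xi> w))\<^sup>2 = (norm w)\<^sup>2 - (w \<bullet> \<xi>)\<^sup>2"
    unfolding tangential_part_def power2_norm_eq_inner
    by (simp add: inner_diff_left inner_diff_right inner_commute norm_eq_1 power2_eq_square)
  then show ?thesis
    by (smt (verit) norm_ge_zero power2_le_imp_le zero_le_power2)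
qed

text \<open>
  The derivative of \<open>z / |z|\<close> is the projection to the tangent space divided by \<open>|z|\<close>, so only the
  tangential part of the gradient survives.
\<close>

lemma has_derivative_radial_extension:
  fixes f :: "real ^ 'n \<Rightarrow> real"
  assumes C1: "C1_with_gradient f F" and z: "z \<noteq> 0"
  shows "((\<lambda>z. f (sgn z)) has_derivative
           (\<lambda>h. (tangential_part (sgn z) (F (sgn z)) \<bullet> h) / norm z)) (at z)"
proof -
  have f: "(f has_derivative (\<lambda>h. F (sgn z) \<bullet> h)) (at (sgn z))"
    using C1 by (simp add: C1_with_gradient_def gderiv_def inner_commute)
  have n: "(norm has_derivative (\<lambda>h. sgn z \<bullet> h)) (at z)"
    using has_derivative_norm[OF z] by (simp add: inner_commute)
  have s: "((\<lambda>z. z /\<^sub>R norm z) has_derivative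
      (\<lambda>h. (h - (sgn z \<bullet> h) *\<^sub>R sgn z) /\<^sub>R norm z)) (at z)"
    using z by (auto intro!: derivative_eq_intros n simp: fun_eq_iff sgn_div_norm algebra_simps
        power2_eq_square)
  have s': "(sgn has_derivative (\<lambda>h. (h - (sgn z \<bullet> h) *\<^sub>R sgn z) /\<^sub>R norm z)) (at z)"
    using s by (simp add: sgn_div_norm[abs_def])
  have "((\<lambda>z. f (sgn z)) has_derivative (\<lambda>h. F (sgn z) \<bullet> ((h - (sgn z \<bullet> h) *\<^sub>R sgn z) /\<^sub>R norm z))) (at z)"
    by (rule has_derivative_compose[OF s' f])
  moreover have "F (sgn z) \<bullet> ((h - (sgn z \<bullet> h) *\<^sub>R sgn z) /\<^sub>R norm z) =
      (tangential_part (sgn z) (F (sgn z)) \<bullet> h) / norm z" for h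
    by (simp add: tangential_part_def inner_diff_left inner_diff_right divide_inverse)
  ultimately show ?thesis by simp
qed

lemma square_integral_unit_interval_le:
  fixes \<phi> :: "real \<Rightarrow> real"
  assumes "continuous_on {0..1} \<phi>"
  shows "(integral {0..1} \<phi>)\<^sup>2 \<le> integral {0..1} (\<lambda>t. (\<phi> t)\<^sup>2)"
proof -
  \<comment> \<open>The variance about the mean value is nonnegative.\<close>
  define c where "c = integral {0..1} \<phi>"
  have 1: "\<phi> integrable_on {0..1}" "(\<lambda>t. (\<phi> t)\<^sup>2) integrable_on {0..1}"
    using assms by (auto intro!: integrable_continuous_interval continuous_intros)
  have "0 \<le> integral {0..1} (\<lambda>t. (\<phi> t - c)\<^sup>2)"
    using assms by (intro integral_nonneg integrable_continuous_interval continuous_intros) auto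
  also have "((\<lambda>t. (\<phi> t)\<^sup>2 - 2 * c * \<phi> t + c\<^sup>2) has_integral
      (integral {0..1} (\<lambda>t. (\<phi> t)\<^sup>2) - 2 * c * c + c\<^sup>2)) {0..1}"
    using has_integral_const_real[of "c\<^sup>2" 0 1] 1 unfolding c_def
    by (intro has_integral_add has_integral_diff has_integral_mult_right integrable_integral) auto
  then have "integral {0..1} (\<lambda>t. (\<phi> t - c)\<^sup>2) = integral {0..1} (\<lambda>t. (\<phi> t)\<^sup>2) - 2 * c * c + c\<^sup>2"
    by (intro integral_unique) (simp add: power2_diff algebra_simps)
  finally show ?thesis by (simp add: c_def power2_eq_square)
qed

text \<open>
  The fundamental theorem of calculus along the segment, followed by the Cauchy-Schwarz inequality
  in the parameter and in the inner product. The extension is differentiable on the whole segment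
  because the segment avoids the origin.
\<close>

lemma radial_extension_segment_bound:
  fixes f :: "real ^ 'n \<Rightarrow> real"
  assumes C1: "C1_with_gradient f F" and nz: "0 \<notin> closed_segment x y"
  shows "ennreal ((f (sgn x) - f (sgn y))\<^sup>2) \<le>
    (\<integral>\<^sup>+ t. ennreal ((norm (x - y))\<^sup>2) *
       (ennreal ((norm (tangential_part (sgn ((1 - t) *\<^sub>R x + t *\<^sub>R y)) (F (sgn ((1 - t) *\<^sub>R x + t *\<^sub>R y)))))\<^sup>2) *
        ennreal (1 / (norm ((1 - t) *\<^sub>R x + t *\<^sub>R y))\<^sup>2)) * indicator {0..1} t \<partial>lborel)"
proof -
  define z where "z = (\<lambda>t. (1 - t) *\<^sub>R x + t *\<^sub>R y)"
  define G where "G = (\<lambda>z. tangential_part (sgn z) (F (sgn z)))"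
  define \<phi> where "\<phi> = (\<lambda>t. (G (z t) \<bullet> (y - x)) / norm (z t))"
  have z0: "z t \<noteq> 0" if "t \<in> {0..1}" for t
    using nz that by (auto simp: z_def closed_segment_def)
  have contF: "continuous_on S F" for S
    using C1 by (auto simp: C1_with_gradient_def intro: continuous_on_subset)
  have contz: "continuous_on {0..1} z"
    unfolding z_def by (intro continuous_intros)
  have contG: "continuous_on {0..1} (\<lambda>t. G (z t))"
    unfolding G_def tangential_part_def sgn_div_norm
    by (intro continuous_intros contz continuous_on_compose2[OF contF[of UNIV]]) (auto simp: z0)
  have cont: "continuous_on {0..1} \<phi>"
    unfolding \<phi>_def by (intro continuous_intros contG contz) (auto simp: z0)
  have "((\<lambda>t. f (sgn (z t))) has_vector_derivative \<phi> t) (at t within {0..1})" if "t \<in> {0..1}" for t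
  proof -
    have dz: "(z has_derivative (\<lambda>h. h *\<^sub>R (y - x))) (at t within {0..1})"
      unfolding z_def by (auto intro!: derivative_eq_intros simp: algebra_simps)
    show ?thesis
      using has_derivative_compose[OF dz has_derivative_radial_extension[OF C1 z0[OF that]]]
      by (simp add: has_vector_derivative_def \<phi>_def G_def)
  qed
  from fundamental_theorem_of_calculus[OF _ this]
  have "(\<phi> has_integral (f (sgn y) - f (sgn x))) {0..1}"
    by (simp add: z_def)
  then have "(f (sgn x) - f (sgn y))\<^sup>2 = (integral {0..1} \<phi>)\<^sup>2"
    by (simp add: integral_unique power2_commute)
  also have "\<dots> \<le> integral {0..1} (\<lambda>t. (\<phi> t)\<^sup>2)"
    by (rule square_integral_unit_interval_le[OF cont])
  finally have "ennreal ((f (sgn x) - f (sgn y))\<^sup>2) \<le> ennreal (integral {0..1} (\<lambda>t. (\<phi> t)\<^sup>2))"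
    by (rule ennreal_leI)
  also have "\<dots> = (\<integral>\<^sup>+ t. ennreal (indicator {0..1} t * (\<phi> t)\<^sup>2) \<partial>lborel)"
    using cont by (intro nn_integral_has_integral_lebesgue[symmetric] integrable_integral
        integrable_continuous_interval continuous_intros) auto
  also have "\<dots> \<le> (\<integral>\<^sup>+ t. ennreal ((norm (x - y))\<^sup>2) * (ennreal ((norm (G (z t)))\<^sup>2) *
      ennreal (1 / (norm (z t))\<^sup>2)) * indicator {0..1} t \<partial>lborel)"
  proof (rule nn_integral_mono)
    fix t :: real
    have "(\<phi> t)\<^sup>2 \<le> (norm (G (z t)) * norm (y - x) / norm (z t))\<^sup>2"
      unfolding \<phi>_def using Cauchy_Schwarz_ineq2[of "G (z t)" "y - x"]
      by (intro abs_le_square_iff[THEN iffD1]) (simp add: divide_right_mono)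
    then have "(\<phi> t)\<^sup>2 \<le> (norm (x - y))\<^sup>2 * ((norm (G (z t)))\<^sup>2 * (1 / (norm (z t))\<^sup>2))"
      by (simp add: power_mult_distrib power_divide norm_minus_commute mult.commute)
    then show "ennreal (indicator {0..1} t * (\<phi> t)\<^sup>2) \<le> ennreal ((norm (x - y))\<^sup>2) *
      (ennreal ((norm (G (z t)))\<^sup>2) * ennreal (1 / (norm (z t))\<^sup>2)) * indicator {0..1} t"
      by (auto simp: indicator_def ennreal_mult[symmetric] ennreal_leI)
  qed
  finally show ?thesis by (simp add: G_def z_def)
qed

text \<open>
  One of the two endpoints moves the point of the segment by a factor of at least 1/2. Integrating
  over that endpoint first, the affine change of variables costs at most \<open>2\<^sup>N\<close>, and the image stays
  in the ball by convexity.
\<close>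

lemma nn_integral_cball_segment_le:
  fixes h :: "'a::euclidean_space \<Rightarrow> ennreal"
  assumes h [measurable]: "h \<in> borel_measurable borel" and t: "0 \<le> t" "t \<le> 1"
  shows "(\<integral>\<^sup>+ x. \<integral>\<^sup>+ y. h ((1 - t) *\<^sub>R x + t *\<^sub>R y) * indicator (cball 0 1) x * indicator (cball 0 1) y
      \<partial>lborel \<partial>lborel)
    \<le> ennreal (2 ^ DIM('a)) * emeasure lborel (cball 0 1 :: 'a set) * (\<integral>\<^sup>+ z. h z * indicator (cball 0 1) z \<partial>lborel)"
proof -
  let ?B = "cball 0 1 :: 'a set"
  define J where "J = (\<integral>\<^sup>+ z. h z * indicator ?B z \<partial>lborel)"
  \<comment> \<open>The case in which the second endpoint has the larger weight; the other one follows by symmetry.\<close>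
  have half: "(\<integral>\<^sup>+ x. \<integral>\<^sup>+ y. h ((1 - s) *\<^sub>R x + s *\<^sub>R y) * indicator ?B x * indicator ?B y \<partial>lborel \<partial>lborel)
      \<le> ennreal (2 ^ DIM('a)) * emeasure lborel ?B * J" if s: "1 / 2 \<le> s" "s \<le> 1" for s
  proof -
    have "(\<integral>\<^sup>+ y. h ((1 - s) *\<^sub>R x + s *\<^sub>R y) * indicator ?B x * indicator ?B y \<partial>lborel)
        \<le> ennreal (2 ^ DIM('a)) * J * indicator ?B x" for x
    proof -
      have "(\<integral>\<^sup>+ y. h ((1 - s) *\<^sub>R x + s *\<^sub>R y) * indicator ?B x * indicator ?B y \<partial>lborel)
          \<le> (\<integral>\<^sup>+ y. (h ((1 - s) *\<^sub>R x + s *\<^sub>R y) * indicator ?B ((1 - s) *\<^sub>R x + s *\<^sub>R y)) * indicator ?B x \<partial>lborel)"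
      proof (intro nn_integral_mono)
        fix y
        have "(1 - s) *\<^sub>R x + s *\<^sub>R y \<in> ?B" if "x \<in> ?B" "y \<in> ?B"
          using that s by (intro convexD[OF convex_cball]) auto
        then show "h ((1 - s) *\<^sub>R x + s *\<^sub>R y) * indicator ?B x * indicator ?B y
            \<le> (h ((1 - s) *\<^sub>R x + s *\<^sub>R y) * indicator ?B ((1 - s) *\<^sub>R x + s *\<^sub>R y)) * indicator ?B x"
          unfolding indicator_def by auto
      qed
      also have "\<dots> = (\<integral>\<^sup>+ y. h ((1 - s) *\<^sub>R x + s *\<^sub>R y) * indicator ?B ((1 - s) *\<^sub>R x + s *\<^sub>R y) \<partial>lborel) * indicator ?B x"
        by (rule nn_integral_multc) measurable
      also have "\<dots> = ennreal ((1 / s) ^ DIM('a)) * J * indicator ?B x"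
        unfolding J_def using s by (subst nn_integral_lborel_affine) auto
      also have "\<dots> \<le> ennreal (2 ^ DIM('a)) * J * indicator ?B x"
        using s by (intro mult_right_mono ennreal_leI power_mono) (auto simp: field_simps)
      finally show ?thesis .
    qed
    then have "(\<integral>\<^sup>+ x. \<integral>\<^sup>+ y. h ((1 - s) *\<^sub>R x + s *\<^sub>R y) * indicator ?B x * indicator ?B y \<partial>lborel \<partial>lborel)
        \<le> (\<integral>\<^sup>+ x. ennreal (2 ^ DIM('a)) * J * indicator ?B x \<partial>lborel)"
      by (intro nn_integral_mono)
    also have "\<dots> = ennreal (2 ^ DIM('a)) * emeasure lborel ?B * J"
      by (subst nn_integral_cmult_indicator) (auto simp: mult_ac)
    finally show ?thesis .
  qed
  show ?thesis
  proof (cases "1 / 2 \<le> t")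
    case True
    from half[OF this t(2)] show ?thesis by (simp add: J_def)
  next
    case False
    have "(\<integral>\<^sup>+ x. \<integral>\<^sup>+ y. h ((1 - t) *\<^sub>R x + t *\<^sub>R y) * indicator ?B x * indicator ?B y \<partial>lborel \<partial>lborel)
        = (\<integral>\<^sup>+ y. \<integral>\<^sup>+ x. h ((1 - t) *\<^sub>R x + t *\<^sub>R y) * indicator ?B x * indicator ?B y \<partial>lborel \<partial>lborel)"
    proof -
      have "(\<lambda>(y, x). h ((1 - t) *\<^sub>R x + t *\<^sub>R y) * indicator ?B x * indicator ?B y)
          \<in> borel_measurable (lborel \<Otimes>\<^sub>M lborel)"
        by measurable
      from lborel_pair.Fubini'[OF this] show ?thesis by simp
    qed
    also have "\<dots> \<le> ennreal (2 ^ DIM('a)) * emeasure lborel ?B * J"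
      using half[of "1 - t"] False t by (simp add: add.commute mult_ac)
    finally show ?thesis by (simp add: J_def)
  qed
qed

text \<open>
  A segment that starts at \<open>x\<close> meets the origin only if its other end lies on the line through
  \<open>x\<close>, which is a null set.
\<close>

lemma AE_zero_notin_closed_segment:
  fixes x :: "'a::euclidean_space"
  assumes x: "x \<noteq> 0" and dim: "DIM('a) \<ge> 2"
  shows "AE y in lborel. 0 \<notin> closed_segment x y"
proof -
  have "negligible (span {x})"
    using dim dim_le_card[of "{x}" "span {x}"] by (intro negligible_lowdim) (auto simp: dim_insert)
  then have "span {x} \<in> null_sets lebesgue"
    by (simp add: negligible_iff_null_sets)
  then have "span {x} \<in> null_sets lborel"
    by (subst (asm) null_sets_completion_iff) (auto intro: borel_closed closed_span)
  then have "AE y in lborel. y \<notin> span {x}"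
    by (rule AE_not_in)
  then show ?thesis
  proof (rule eventually_mono)
    fix y assume y: "y \<notin> span {x}"
    show "0 \<notin> closed_segment x y"
    proof
      assume "0 \<in> closed_segment x y"
      then obtain u where u: "0 = (1 - u) *\<^sub>R x + u *\<^sub>R y"
        by (auto simp: closed_segment_def)
      with x have "u \<noteq> 0" by auto
      have "y = (1 / u) *\<^sub>R (u *\<^sub>R y)"
        using \<open>u \<noteq> 0\<close> by simp
      also have "u *\<^sub>R y = - ((1 - u) *\<^sub>R x)"
        using u by (simp add: eq_neg_iff_add_eq_0 add.commute)
      finally have "y \<in> span {x}"
        by (simp add: span_scale span_neg span_base)
      then show False
        using y by simp
    qed
  qed
qed

lemma C1_with_gradient_measurable:
  assumes "C1_with_gradient f F"
  shows "f \<in> borel_measurable borel" "F \<in> borel_measurable borel"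
    "(\<lambda>\<xi>. tangential_part \<xi> (F \<xi>)) \<in> borel_measurable borel"
proof -
  have "isCont f x" for x
    using assms unfolding C1_with_gradient_def gderiv_def by (meson has_derivative_continuous)
  then have "continuous_on UNIV f"
    by (simp add: continuous_at_imp_continuous_on)
  then show "f \<in> borel_measurable borel"
    by (rule borel_measurable_continuous_onI)
  show F [measurable]: "F \<in> borel_measurable borel"
    using assms by (auto simp: C1_with_gradient_def intro: borel_measurable_continuous_onI)
  show "(\<lambda>\<xi>. tangential_part \<xi> (F \<xi>)) \<in> borel_measurable borel"
    unfolding tangential_part_def by measurable
qed

text \<open>
  The constant collects the squared diameter 4 of the ball, the factor \<open>2\<^sup>N\<close> for the mean over
  segments, and the factor 8 for the weight \<open>|z|\<^sup>-\<^sup>2\<close>.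
\<close>

lemma radial_extension_ball_poincare:
  fixes f :: "real ^ 'n \<Rightarrow> real"
  assumes C1: "C1_with_gradient f F" and N: "CARD('n) \<ge> 3"
  defines "B \<equiv> cball 0 1 :: (real ^ 'n) set"
  shows "(\<integral>\<^sup>+ x. \<integral>\<^sup>+ y. ennreal ((f (sgn x) - f (sgn y))\<^sup>2) * indicator B x * indicator B y \<partial>lborel \<partial>lborel)
    \<le> ennreal (32 * 2 ^ CARD('n)) * emeasure lborel B *
       (\<integral>\<^sup>+ z. ennreal ((norm (tangential_part (sgn z) (F (sgn z))))\<^sup>2) * indicator B z \<partial>lborel)"
proof -
  note [measurable] = C1_with_gradient_measurable[OF C1]
  define k where "k = (\<lambda>\<xi>. ennreal ((norm (tangential_part \<xi> (F \<xi>)))\<^sup>2))"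
  define h where "h = (\<lambda>z. k (sgn z) * ennreal (1 / (norm z)\<^sup>2))"
  have k [measurable]: "k \<in> borel_measurable borel"
    unfolding k_def by measurable
  have h [measurable]: "h \<in> borel_measurable borel"
    unfolding h_def by measurable
  have B [measurable]: "B \<in> sets borel" by (simp add: B_def)
  define J where "J = (\<integral>\<^sup>+ z. h z * indicator B z \<partial>lborel)"
  define H where "H = (\<lambda>x y t. h ((1 - t) *\<^sub>R x + t *\<^sub>R y) * indicator B x * indicator B y)"
  have "(\<integral>\<^sup>+ x. \<integral>\<^sup>+ y. ennreal ((f (sgn x) - f (sgn y))\<^sup>2) * indicator B x * indicator B y \<partial>lborel \<partial>lborel)
    \<le> (\<integral>\<^sup>+ x. \<integral>\<^sup>+ y. \<integral>\<^sup>+ t. 4 * (H x y t * indicator {0..1} t) \<partial>lborel \<partial>lborel \<partial>lborel)"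
  proof (rule nn_integral_mono_AE)
    show "AE x in lborel. (\<integral>\<^sup>+ y. ennreal ((f (sgn x) - f (sgn y))\<^sup>2) * indicator B x * indicator B y \<partial>lborel)
      \<le> (\<integral>\<^sup>+ y. \<integral>\<^sup>+ t. 4 * (H x y t * indicator {0..1} t) \<partial>lborel \<partial>lborel)"
      using AE_lborel_singleton[of "0 :: real ^ 'n"]
    proof (rule eventually_mono)
      fix x :: "real ^ 'n" assume x: "x \<noteq> 0"
      have "AE y in lborel. 0 \<notin> closed_segment x y"
        using N by (intro AE_zero_notin_closed_segment x) simp
      then have "AE y in lborel. ennreal ((f (sgn x) - f (sgn y))\<^sup>2) * indicator B x * indicator B y
          \<le> (\<integral>\<^sup>+ t. 4 * (H x y t * indicator {0..1} t) \<partial>lborel)"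
      proof (rule eventually_mono)
        fix y :: "real ^ 'n" assume nz: "0 \<notin> closed_segment x y"
        show "ennreal ((f (sgn x) - f (sgn y))\<^sup>2) * indicator B x * indicator B y
          \<le> (\<integral>\<^sup>+ t. 4 * (H x y t * indicator {0..1} t) \<partial>lborel)"
        proof (cases "x \<in> B \<and> y \<in> B")
          case True
          then have "norm (x - y) \<le> 2"
            using norm_triangle_ineq4[of x y] by (simp add: B_def)
          then have "(norm (x - y))\<^sup>2 \<le> 4"
            using power_mono[of "norm (x - y)" 2 2] by simp
          then have n: "ennreal ((norm (x - y))\<^sup>2) \<le> 4"
            using ennreal_leI by fastforce
          have "ennreal ((f (sgn x) - f (sgn y))\<^sup>2) \<le> (\<integral>\<^sup>+ t. ennreal ((norm (x - y))\<^sup>2) *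
              h ((1 - t) *\<^sub>R x + t *\<^sub>R y) * indicator {0..1} t \<partial>lborel)"
            using radial_extension_segment_bound[OF C1 nz] unfolding h_def k_def .
          also have "\<dots> \<le> (\<integral>\<^sup>+ t. 4 * (H x y t * indicator {0..1} t) \<partial>lborel)"
          proof (rule nn_integral_mono)
            fix t :: real
            have "H x y t = h ((1 - t) *\<^sub>R x + t *\<^sub>R y)"
              using True by (simp add: H_def)
            then show "ennreal ((norm (x - y))\<^sup>2) * h ((1 - t) *\<^sub>R x + t *\<^sub>R y) * indicator {0..1} t
              \<le> 4 * (H x y t * indicator {0..1} t)"
              using n by (simp only: mult.assoc mult_right_mono zero_le)
          qed
          finally show ?thesis
            using True by simp
        next
          case False
          then show ?thesis by (cases "x \<in> B") simp_all
        qed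
      qed
      then show "(\<integral>\<^sup>+ y. ennreal ((f (sgn x) - f (sgn y))\<^sup>2) * indicator B x * indicator B y \<partial>lborel)
        \<le> (\<integral>\<^sup>+ y. \<integral>\<^sup>+ t. 4 * (H x y t * indicator {0..1} t) \<partial>lborel \<partial>lborel)"
        by (rule nn_integral_mono_AE)
    qed
  qed
  also have "\<dots> = (\<integral>\<^sup>+ x. \<integral>\<^sup>+ t. \<integral>\<^sup>+ y. 4 * (H x y t * indicator {0..1} t) \<partial>lborel \<partial>lborel \<partial>lborel)"
  proof (rule nn_integral_cong)
    fix x :: "real ^ 'n"
    have "(\<lambda>(y, t). 4 * (H x y t * indicator {0..1} t)) \<in> borel_measurable (lborel \<Otimes>\<^sub>M lborel)"
      unfolding H_def by measurable
    from lborel_pair.Fubini'[OF this]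
    show "(\<integral>\<^sup>+ y. \<integral>\<^sup>+ t. 4 * (H x y t * indicator {0..1} t) \<partial>lborel \<partial>lborel) =
        (\<integral>\<^sup>+ t. \<integral>\<^sup>+ y. 4 * (H x y t * indicator {0..1} t) \<partial>lborel \<partial>lborel)"
      by simp
  qed
  also have "\<dots> = (\<integral>\<^sup>+ t. \<integral>\<^sup>+ x. \<integral>\<^sup>+ y. 4 * (H x y t * indicator {0..1} t) \<partial>lborel \<partial>lborel \<partial>lborel)"
  proof -
    have "(\<lambda>(x, t). \<integral>\<^sup>+ y. 4 * (H x y t * indicator {0..1} t) \<partial>lborel) \<in> borel_measurable (lborel \<Otimes>\<^sub>M lborel)"
      unfolding H_def by measurable
    from lborel_pair.Fubini'[OF this] show ?thesis by simp
  qed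
  also have "\<dots> \<le> (\<integral>\<^sup>+ t. (4 * (ennreal (2 ^ CARD('n)) * emeasure lborel B * J)) * indicator {0..1::real} t \<partial>lborel)"
  proof (rule nn_integral_mono)
    fix t :: real
    have [measurable]: "(\<lambda>y. H x y t) \<in> borel_measurable borel"
      "(\<lambda>x. \<integral>\<^sup>+ y. H x y t \<partial>lborel) \<in> borel_measurable borel" for x
      unfolding H_def by measurable
    have "(\<integral>\<^sup>+ x. \<integral>\<^sup>+ y. 4 * (H x y t * indicator {0..1} t) \<partial>lborel \<partial>lborel)
      = 4 * (\<integral>\<^sup>+ x. \<integral>\<^sup>+ y. H x y t \<partial>lborel \<partial>lborel) * indicator {0..1} t"
      by (simp add: nn_integral_cmult nn_integral_multc mult.assoc)
    also have "\<dots> \<le> (4 * (ennreal (2 ^ CARD('n)) * emeasure lborel B * J)) * indicator {0..1} t"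
      using nn_integral_cball_segment_le[OF h, of t]
      by (auto simp: indicator_def[of "{0..1::real}"] H_def J_def B_def intro!: mult_left_mono)
    finally show "(\<integral>\<^sup>+ x. \<integral>\<^sup>+ y. 4 * (H x y t * indicator {0..1} t) \<partial>lborel \<partial>lborel)
      \<le> (4 * (ennreal (2 ^ CARD('n)) * emeasure lborel B * J)) * indicator {0..1} t" .
  qed
  also have "\<dots> = 4 * (ennreal (2 ^ CARD('n)) * emeasure lborel B * J)"
    by (subst nn_integral_cmult_indicator) auto
  also have "\<dots> \<le> 4 * (ennreal (2 ^ CARD('n)) * emeasure lborel B * (8 * (\<integral>\<^sup>+ z. k (sgn z) * indicator B z \<partial>lborel)))"
    using nn_integral_radial_weight[OF k] N
    unfolding J_def h_def B_def by (intro mult_left_mono) auto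
  also have "\<dots> = ennreal (32 * 2 ^ CARD('n)) * emeasure lborel B * (\<integral>\<^sup>+ z. k (sgn z) * indicator B z \<partial>lborel)"
  proof -
    have "ennreal (32 * 2 ^ CARD('n)) = 4 * 8 * ennreal (2 ^ CARD('n))"
      by (subst ennreal_mult) auto
    then show ?thesis by (simp only: mult_ac)
  qed
  finally show ?thesis by (simp add: k_def)
qed

lemma sphere_poincare_C1:
  fixes f :: "real ^ 'n \<Rightarrow> real"
  assumes C1: "C1_with_gradient f F" and N: "CARD('n) \<ge> 3"
  shows "(\<integral>\<^sup>+ \<xi>. \<integral>\<^sup>+ \<eta>. ennreal ((f \<xi> - f \<eta>)\<^sup>2) \<partial>sphere_measure \<partial>sphere_measure)
    \<le> ennreal (32 * 2 ^ CARD('n)) * sphere_mass TYPE('n) *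
       (\<integral>\<^sup>+ \<xi>. ennreal ((norm (tangential_part \<xi> (F \<xi>)))\<^sup>2) \<partial>sphere_measure)"
proof -
  note [measurable] = C1_with_gradient_measurable[OF C1]
  let ?B = "cball 0 1 :: (real ^ 'n) set"
  let ?N = "of_nat CARD('n) :: ennreal"
  have inner: "(\<integral>\<^sup>+ \<eta>. ennreal ((f \<xi> - f \<eta>)\<^sup>2) \<partial>sphere_measure) =
      ?N * (\<integral>\<^sup>+ y. ennreal ((f \<xi> - f (sgn y))\<^sup>2) * indicator ?B y \<partial>lborel)" for \<xi>
    by (rule nn_integral_sphere_measure) measurable
  have "(\<integral>\<^sup>+ \<xi>. \<integral>\<^sup>+ \<eta>. ennreal ((f \<xi> - f \<eta>)\<^sup>2) \<partial>sphere_measure \<partial>sphere_measure) =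
      ?N * (\<integral>\<^sup>+ x. (?N * (\<integral>\<^sup>+ y. ennreal ((f (sgn x) - f (sgn y))\<^sup>2) * indicator ?B y \<partial>lborel)) * indicator ?B x \<partial>lborel)"
    unfolding inner by (rule nn_integral_sphere_measure) measurable
  also have "(\<integral>\<^sup>+ x. (?N * (\<integral>\<^sup>+ y. ennreal ((f (sgn x) - f (sgn y))\<^sup>2) * indicator ?B y \<partial>lborel)) * indicator ?B x \<partial>lborel)
    = (\<integral>\<^sup>+ x. ?N * (\<integral>\<^sup>+ y. ennreal ((f (sgn x) - f (sgn y))\<^sup>2) * indicator ?B x * indicator ?B y \<partial>lborel) \<partial>lborel)"
  proof (rule nn_integral_cong)
    fix x :: "real ^ 'n"
    show "(?N * (\<integral>\<^sup>+ y. ennreal ((f (sgn x) - f (sgn y))\<^sup>2) * indicator ?B y \<partial>lborel)) * indicator ?B x =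
      ?N * (\<integral>\<^sup>+ y. ennreal ((f (sgn x) - f (sgn y))\<^sup>2) * indicator ?B x * indicator ?B y \<partial>lborel)"
      by (cases "x \<in> ?B") simp_all
  qed
  also have "\<dots> = ?N * (\<integral>\<^sup>+ x. \<integral>\<^sup>+ y. ennreal ((f (sgn x) - f (sgn y))\<^sup>2) * indicator ?B x * indicator ?B y \<partial>lborel \<partial>lborel)"
    by (rule nn_integral_cmult) measurable
  also have "?N * \<dots> \<le> ?N * (?N * (ennreal (32 * 2 ^ CARD('n)) * emeasure lborel ?B *
       (\<integral>\<^sup>+ z. ennreal ((norm (tangential_part (sgn z) (F (sgn z))))\<^sup>2) * indicator ?B z \<partial>lborel)))"
    by (intro mult_left_mono radial_extension_ball_poincare[OF C1 N]) auto
  also have "\<dots> = ennreal (32 * 2 ^ CARD('n)) * sphere_mass TYPE('n) *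
       (?N * (\<integral>\<^sup>+ z. ennreal ((norm (tangential_part (sgn z) (F (sgn z))))\<^sup>2) * indicator ?B z \<partial>lborel))"
    unfolding sphere_mass_eq by (simp only: mult_ac)
  also have "?N * (\<integral>\<^sup>+ z. ennreal ((norm (tangential_part (sgn z) (F (sgn z))))\<^sup>2) * indicator ?B z \<partial>lborel)
      = (\<integral>\<^sup>+ \<xi>. ennreal ((norm (tangential_part \<xi> (F \<xi>)))\<^sup>2) \<partial>sphere_measure)"
    by (rule nn_integral_sphere_measure[symmetric]) measurable
  finally show ?thesis .
qed

lemma tangential_part_diff:
  "tangential_part \<xi> (v - w) = tangential_part \<xi> v - tangential_part \<xi> w"
  by (simp add: tangential_part_def inner_diff_left scaleR_diff_left)

lemma tangential_part_idem:
  "norm \<xi> = 1 \<Longrightarrow> tangential_part \<xi> (tangential_part \<xi> w) = tangential_part \<xi> w"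
  by (simp add: tangential_part_def inner_diff_left norm_eq_1)

lemma measurable_tangential_part:
  assumes [measurable]: "g \<in> borel_measurable sphere_measure"
  shows "(\<lambda>\<xi>. tangential_part \<xi> (g \<xi>)) \<in> borel_measurable sphere_measure"
proof -
  have [measurable]: "(\<lambda>\<xi>. \<xi>) \<in> borel_measurable sphere_measure"
    by (rule borel_measurable_sphere_measureI) measurable
  show ?thesis unfolding tangential_part_def by measurable
qed

text \<open>
  Passage to the limit in the \<open>C\<^sup>1\<close> case. Working with the double integral of squared differences
  instead of the variance avoids mean values. The constant grows by a factor of 6: 3 from splitting
  a difference into three parts, 2 from splitting the gradient into two. The representative \<open>g\<close> of
  the gradient enters through its tangential part, which is a contraction and hence keeps the
  \<open>L\<^sup>2\<close> convergence.
\<close>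

lemma sphere_poincare:
  fixes \<phi> :: "real ^ 'n \<Rightarrow> real"
  assumes grad: "has_sphere_gradient \<phi> g" and N: "CARD('n) \<ge> 3"
  shows "(\<integral>\<^sup>+ \<xi>. \<integral>\<^sup>+ \<eta>. ennreal ((\<phi> \<xi> - \<phi> \<eta>)\<^sup>2) \<partial>sphere_measure \<partial>sphere_measure)
    \<le> ennreal (192 * 2 ^ CARD('n)) * sphere_mass TYPE('n) *
       (\<integral>\<^sup>+ \<xi>. ennreal ((norm (tangential_part \<xi> (g \<xi>)))\<^sup>2) \<partial>sphere_measure)"
proof -
  let ?S = "sphere_measure :: (real ^ 'n) measure"
  let ?C = "ennreal (32 * 2 ^ CARD('n))"
  let ?m = "sphere_mass TYPE('n)"
  interpret finite_measure ?S by simp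
  have m_fin: "?m < top"
    using sphere_mass_finite[where 'n='n] unfolding less_top .
  obtain f F where C1: "\<And>k::nat. C1_with_gradient (f k) (F k)"
    and lim_f: "(\<lambda>k. \<integral>\<^sup>+ \<xi>. ennreal ((f k \<xi> - \<phi> \<xi>)\<^sup>2) \<partial>?S) \<longlonglongrightarrow> 0"
    and lim_F: "(\<lambda>k. \<integral>\<^sup>+ \<xi>. ennreal ((norm (tangential_part \<xi> (F k \<xi>) - g \<xi>))\<^sup>2) \<partial>?S) \<longlonglongrightarrow> 0"
    and [measurable]: "\<phi> \<in> borel_measurable ?S" "g \<in> borel_measurable ?S"
    using grad unfolding has_sphere_gradient_def by blast
  have [measurable]: "f k \<in> borel_measurable ?S" "(\<lambda>\<xi>. tangential_part \<xi> (F k \<xi>)) \<in> borel_measurable ?S"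
    "(\<lambda>\<xi>. tangential_part \<xi> (g \<xi>)) \<in> borel_measurable ?S" for k
    using C1_with_gradient_measurable[OF C1] measurable_tangential_part[of g]
    by (auto intro: borel_measurable_sphere_measureI)
  define e where "e k = (\<integral>\<^sup>+ \<xi>. ennreal ((f k \<xi> - \<phi> \<xi>)\<^sup>2) \<partial>?S)" for k
  define d where "d k = (\<integral>\<^sup>+ \<xi>. ennreal ((norm (tangential_part \<xi> (F k \<xi>) - g \<xi>))\<^sup>2) \<partial>?S)" for k
  define G where "G = (\<integral>\<^sup>+ \<xi>. ennreal ((norm (tangential_part \<xi> (g \<xi>)))\<^sup>2) \<partial>?S)"
  have grad_k: "(\<integral>\<^sup>+ \<xi>. ennreal ((norm (tangential_part \<xi> (F k \<xi>)))\<^sup>2) \<partial>?S) \<le> 2 * G + 2 * d k" for k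
  proof -
    have "(\<integral>\<^sup>+ \<xi>. ennreal ((norm (tangential_part \<xi> (F k \<xi>)))\<^sup>2) \<partial>?S) \<le>
      (\<integral>\<^sup>+ \<xi>. 2 * ennreal ((norm (tangential_part \<xi> (g \<xi>)))\<^sup>2) +
        2 * ennreal ((norm (tangential_part \<xi> (F k \<xi>) - g \<xi>))\<^sup>2) \<partial>?S)"
    proof (rule nn_integral_mono)
      fix \<xi> assume "\<xi> \<in> space ?S"
      then have 1: "norm \<xi> = 1" by (simp add: space_sphere_measure)
      let ?p = "norm (tangential_part \<xi> (g \<xi>))" and ?q = "norm (tangential_part \<xi> (F k \<xi>) - g \<xi>)"
      have "norm (tangential_part \<xi> (F k \<xi>) - tangential_part \<xi> (g \<xi>)) \<le> ?q"
        using norm_tangential_part_le[OF 1, of "tangential_part \<xi> (F k \<xi>) - g \<xi>"]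
        by (simp add: tangential_part_diff tangential_part_idem[OF 1])
      then have "norm (tangential_part \<xi> (F k \<xi>)) \<le> ?p + ?q"
        using norm_triangle_sub[of "tangential_part \<xi> (F k \<xi>)" "tangential_part \<xi> (g \<xi>)"] by linarith
      then have "(norm (tangential_part \<xi> (F k \<xi>)))\<^sup>2 \<le> (?p + ?q)\<^sup>2"
        by (intro power_mono) auto
      also have "\<dots> \<le> 2 * ?p\<^sup>2 + 2 * ?q\<^sup>2"
        using sum_squares_bound[of ?p ?q] by (simp add: power2_sum)
      finally have "ennreal ((norm (tangential_part \<xi> (F k \<xi>)))\<^sup>2) \<le> ennreal (2 * ?p\<^sup>2 + 2 * ?q\<^sup>2)"
        by (rule ennreal_leI)
      then show "ennreal ((norm (tangential_part \<xi> (F k \<xi>)))\<^sup>2) \<le> 2 * ennreal (?p\<^sup>2) + 2 * ennreal (?q\<^sup>2)"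
        by (simp add: ennreal_mult)
    qed
    also have "\<dots> = 2 * G + 2 * d k"
      unfolding G_def d_def by (simp add: nn_integral_add nn_integral_cmult)
    finally show ?thesis .
  qed
  have bound: "(\<integral>\<^sup>+ \<xi>. \<integral>\<^sup>+ \<eta>. ennreal ((\<phi> \<xi> - \<phi> \<eta>)\<^sup>2) \<partial>?S \<partial>?S)
      \<le> 6 * ?m * e k + 3 * ?C * ?m * (2 * G + 2 * d k)" for k
  proof -
    have "(\<integral>\<^sup>+ \<xi>. \<integral>\<^sup>+ \<eta>. ennreal ((\<phi> \<xi> - \<phi> \<eta>)\<^sup>2) \<partial>?S \<partial>?S) \<le>
      (\<integral>\<^sup>+ \<xi>. \<integral>\<^sup>+ \<eta>. 3 * ennreal ((f k \<xi> - \<phi> \<xi>)\<^sup>2) + 3 * ennreal ((f k \<xi> - f k \<eta>)\<^sup>2) +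
        3 * ennreal ((f k \<eta> - \<phi> \<eta>)\<^sup>2) \<partial>?S \<partial>?S)"
    proof (intro nn_integral_mono)
      fix \<xi> \<eta>
      define p q r where "p = f k \<xi> - \<phi> \<xi>" and "q = f k \<xi> - f k \<eta>" and "r = f k \<eta> - \<phi> \<eta>"
      have "\<phi> \<xi> - \<phi> \<eta> = - p + q + r"
        by (simp add: p_def q_def r_def)
      then have "(\<phi> \<xi> - \<phi> \<eta>)\<^sup>2 = (- p + q + r)\<^sup>2"
        by simp
      also have "\<dots> \<le> 3 * p\<^sup>2 + 3 * q\<^sup>2 + 3 * r\<^sup>2"
      proof -
        \<comment> \<open>The difference of the two sides is this sum of squares.\<close>
        have "0 \<le> (p + q)\<^sup>2 + (p + r)\<^sup>2 + (q - r)\<^sup>2" by simp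
        then show ?thesis by (simp add: power2_eq_square algebra_simps)
      qed
      finally have "ennreal ((\<phi> \<xi> - \<phi> \<eta>)\<^sup>2) \<le> ennreal (3 * p\<^sup>2 + 3 * q\<^sup>2 + 3 * r\<^sup>2)"
        by (rule ennreal_leI)
      then show "ennreal ((\<phi> \<xi> - \<phi> \<eta>)\<^sup>2) \<le> 3 * ennreal ((f k \<xi> - \<phi> \<xi>)\<^sup>2) + 3 * ennreal ((f k \<xi> - f k \<eta>)\<^sup>2) +
        3 * ennreal ((f k \<eta> - \<phi> \<eta>)\<^sup>2)"
        by (simp add: ennreal_mult p_def q_def r_def)
    qed
    also have "\<dots> = 3 * ?m * e k + 3 * (\<integral>\<^sup>+ \<xi>. \<integral>\<^sup>+ \<eta>. ennreal ((f k \<xi> - f k \<eta>)\<^sup>2) \<partial>?S \<partial>?S) + 3 * e k * ?m"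
      unfolding e_def
      by (simp add: nn_integral_add nn_integral_cmult nn_integral_multc space_sphere_measure mult_ac)
    also have "\<dots> \<le> 3 * ?m * e k + 3 * (?C * ?m * (2 * G + 2 * d k)) + 3 * e k * ?m"
      by (intro add_mono mult_left_mono order_refl order_trans[OF sphere_poincare_C1[OF C1 N]] grad_k) auto
    also have "\<dots> = 6 * ?m * e k + 3 * ?C * ?m * (2 * G + 2 * d k)"
    proof -
      have "(6 :: ennreal) = 3 + 3" by simp
      then have "6 * ?m * e k = 3 * ?m * e k + 3 * e k * ?m"
        by (simp only: distrib_right distrib_left mult_ac)
      then show ?thesis by (simp only: mult_ac add_ac)
    qed
    finally show ?thesis .
  qed
  have "(\<lambda>k. 6 * ?m * e k + 3 * ?C * ?m * (2 * G + 2 * d k)) \<longlonglongrightarrow>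
      6 * ?m * 0 + 3 * ?C * ?m * (2 * G + 2 * 0)"
    using lim_f lim_F m_fin unfolding e_def[symmetric] d_def[symmetric]
    by (intro tendsto_add ennreal_tendsto_cmult tendsto_const) (auto simp: ennreal_mult_less_top)
  then have "(\<integral>\<^sup>+ \<xi>. \<integral>\<^sup>+ \<eta>. ennreal ((\<phi> \<xi> - \<phi> \<eta>)\<^sup>2) \<partial>?S \<partial>?S)
      \<le> 6 * ?m * 0 + 3 * ?C * ?m * (2 * G + 2 * 0)"
    by (rule LIMSEQ_le_const) (use bound in blast)
  also have "\<dots> = ennreal (192 * 2 ^ CARD('n)) * ?m * G"
  proof -
    have "ennreal (192 * 2 ^ CARD('n)) = ennreal (3 * (32 * 2 ^ CARD('n)) * 2)" by simp
    also have "\<dots> = 3 * ?C * 2" by (simp only: ennreal_mult' ennreal_mult'' ennreal_numeral zero_le_numeral)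
    finally show ?thesis by (simp add: mult_ac)
  qed
  finally show ?thesis by (simp add: G_def)
qed

text \<open>
  Restrict the second variable in the double integral to the zero set of \<open>\<phi>\<close>.
\<close>

lemma sphere_poincare_vanishing_on_half:
  fixes \<phi> :: "real ^ 'n \<Rightarrow> real"
  assumes grad: "has_sphere_gradient \<phi> g" and N: "CARD('n) \<ge> 3"
    and half: "sphere_mass TYPE('n) \<le> 2 * emeasure sphere_measure {\<xi> \<in> sphere 0 1. \<phi> \<xi> = 0}"
  shows "(\<integral>\<^sup>+ \<xi>. ennreal ((\<phi> \<xi>)\<^sup>2) \<partial>sphere_measure)
    \<le> ennreal (384 * 2 ^ CARD('n)) *
       (\<integral>\<^sup>+ \<xi>. ennreal ((norm (tangential_part \<xi> (g \<xi>)))\<^sup>2) \<partial>sphere_measure)"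
proof -
  let ?S = "sphere_measure :: (real ^ 'n) measure"
  let ?m = "sphere_mass TYPE('n)"
  define Z where "Z = {\<xi> \<in> sphere 0 1. \<phi> \<xi> = 0}"
  let ?I = "\<integral>\<^sup>+ \<xi>. ennreal ((\<phi> \<xi>)\<^sup>2) \<partial>?S"
  define G where "G = (\<integral>\<^sup>+ \<xi>. ennreal ((norm (tangential_part \<xi> (g \<xi>)))\<^sup>2) \<partial>?S)"
  interpret finite_measure ?S by simp
  have m: "?m \<noteq> 0" "?m \<noteq> top"
    using sphere_mass_finite[where 'n='n] sphere_mass_pos[where 'n='n] by auto
  have phi [measurable]: "\<phi> \<in> borel_measurable ?S"
    using grad by (simp add: has_sphere_gradient_def)
  have Z [measurable]: "Z \<in> sets ?S"
    using measurable_sets[OF phi, of "{0}"]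
    by (simp add: Z_def vimage_def space_sphere_measure Int_def conj_commute)
  have "?m * ?I \<le> 2 * emeasure ?S Z * ?I"
    unfolding Z_def by (intro mult_right_mono half) auto
  also have "\<dots> = 2 * (\<integral>\<^sup>+ \<xi>. \<integral>\<^sup>+ \<eta>. ennreal ((\<phi> \<xi>)\<^sup>2) * indicator Z \<eta> \<partial>?S \<partial>?S)"
    by (simp add: nn_integral_cmult nn_integral_multc mult_ac)
  also have "\<dots> \<le> 2 * (\<integral>\<^sup>+ \<xi>. \<integral>\<^sup>+ \<eta>. ennreal ((\<phi> \<xi> - \<phi> \<eta>)\<^sup>2) \<partial>?S \<partial>?S)"
    by (intro mult_left_mono nn_integral_mono) (auto simp: indicator_def Z_def)
  also have "\<dots> \<le> 2 * (ennreal (192 * 2 ^ CARD('n)) * ?m * G)"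
    unfolding G_def by (intro mult_left_mono sphere_poincare[OF grad N]) auto
  also have "\<dots> = ?m * (ennreal (384 * 2 ^ CARD('n)) * G)"
  proof -
    have "ennreal (384 * 2 ^ CARD('n)) = ennreal (2 * (192 * 2 ^ CARD('n)))" by simp
    also have "\<dots> = 2 * ennreal (192 * 2 ^ CARD('n))"
      by (simp only: ennreal_mult' ennreal_numeral zero_le_numeral)
    finally show ?thesis by (simp add: mult_ac)
  qed
  finally show ?thesis
    using m by (simp add: ennreal_mult_le_mult_iff G_def)
qed

section \<open>Rayleigh quotients of diagonal matrices\<close>

lemma diag_matrix_vector_mult: "diag_matrix a *v x = (\<chi> i. a i * x $ i)"
proof -
  have "(\<Sum>j\<in>UNIV. (if i = j then a i else 0) * x $ j) = a i * x $ i" for i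
    by (simp add: if_distrib[of "\<lambda>c. c * _"] cong: if_cong)
  then show ?thesis
    by (simp add: diag_matrix_def matrix_vector_mult_def)
qed

lemma diag_matrix_inner: "(diag_matrix a *v x) \<bullet> y = (\<Sum>i\<in>UNIV. a i * x $ i * y $ i)"
  by (simp add: diag_matrix_vector_mult inner_vec_def)

lemma diag_matrix_inner_commute: "(diag_matrix a *v x) \<bullet> y = (diag_matrix a *v y) \<bullet> x"
  by (simp add: diag_matrix_inner mult.commute mult.left_commute)

lemma diag_matrix_one: "diag_matrix (\<lambda>_. 1) = mat 1"
  by (simp add: diag_matrix_def mat_def)

lemma diag_matrix_quadratic_lower:
  assumes "\<forall>i. 1 \<le> a i"
  shows "(norm x)\<^sup>2 \<le> (diag_matrix a *v x) \<bullet> x"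
  unfolding diag_matrix_inner norm_vec_def L2_set_def
  using mult_right_mono[OF assms[rule_format], of "x $ _ * x $ _"]
  by (simp add: sum_nonneg power2_eq_square mult.assoc sum_mono)

lemma diag_matrix_quadratic_upper:
  assumes "\<forall>i. a i \<le> t"
  shows "(diag_matrix a *v x) \<bullet> x \<le> t * (norm x)\<^sup>2"
  unfolding diag_matrix_inner norm_vec_def L2_set_def
  using mult_right_mono[OF assms[rule_format], of "x $ _ * x $ _"]
  by (simp add: sum_nonneg power2_eq_square mult.assoc sum_distrib_left sum_mono)

lemma mu_weight_lower:
  "\<forall>i. 1 \<le> a i \<Longrightarrow> norm \<xi> = 1 \<Longrightarrow> 1 \<le> mu_weight (diag_matrix a) \<xi>"
  using diag_matrix_quadratic_lower[of a \<xi>] by (simp add: mu_weight_def)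

lemma mu_weight_upper:
  "\<forall>i. a i \<le> t \<Longrightarrow> norm \<xi> = 1 \<Longrightarrow> mu_weight (diag_matrix a) \<xi> \<le> t"
  using diag_matrix_quadratic_upper[of a t \<xi>] by (simp add: mu_weight_def)

text \<open>
  \<open>\<nabla>\<^sub>\<theta>\<^sup>A\<close> is the projection along \<open>\<xi>\<close> that is orthogonal for the inner product of \<open>A\<close>. This is
  Pythagoras for that inner product.
\<close>

lemma diag_matrix_quadratic_theta_gradient:
  fixes a :: "'n::finite \<Rightarrow> real"
  assumes "mu_weight (diag_matrix a) \<xi> \<noteq> 0"
  shows "(diag_matrix a *v theta_gradient (diag_matrix a) \<xi> w) \<bullet> theta_gradient (diag_matrix a) \<xi> w
    = (diag_matrix a *v w) \<bullet> w - ((diag_matrix a *v w) \<bullet> \<xi>)\<^sup>2 / mu_weight (diag_matrix a) \<xi>"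
proof -
  let ?A = "diag_matrix a"
  define c where "c = ((?A *v w) \<bullet> \<xi>) / mu_weight ?A \<xi>"
  have "(?A *v (w - c *\<^sub>R \<xi>)) \<bullet> (w - c *\<^sub>R \<xi>)
      = (?A *v w) \<bullet> w - 2 * c * ((?A *v w) \<bullet> \<xi>) + c\<^sup>2 * mu_weight ?A \<xi>"
    using diag_matrix_inner_commute[of a \<xi> w]
    by (simp add: matrix_vector_mult_diff_distrib matrix_vector_mult_scaleR mu_weight_def
        inner_diff_left inner_diff_right power2_eq_square algebra_simps)
  also have "\<dots> = (?A *v w) \<bullet> w - ((?A *v w) \<bullet> \<xi>)\<^sup>2 / mu_weight ?A \<xi>"
    using assms by (simp add: c_def power2_eq_square field_simps)
  finally show ?thesis by (simp add: theta_gradient_def c_def mu_weight_def)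
qed

lemma tangential_part_theta_gradient:
  "norm \<xi> = 1 \<Longrightarrow> tangential_part \<xi> (theta_gradient A \<xi> w) = tangential_part \<xi> w"
  by (simp add: tangential_part_def theta_gradient_def inner_diff_left norm_eq_1 algebra_simps)

text \<open>
  The two projections differ by a normal vector, so they have the same tangential part; and \<open>A\<close>
  dominates the identity.
\<close>

lemma norm_tangential_part_le_quadratic_theta_gradient:
  assumes "\<forall>i. 1 \<le> a i" "norm \<xi> = 1"
  shows "(norm (tangential_part \<xi> w))\<^sup>2 \<le>
    (diag_matrix a *v theta_gradient (diag_matrix a) \<xi> w) \<bullet> theta_gradient (diag_matrix a) \<xi> w"
proof -
  have "norm (tangential_part \<xi> w) \<le> norm (theta_gradient (diag_matrix a) \<xi> w)"
    using norm_tangential_part_le[OF assms(2)] tangential_part_theta_gradient[OF assms(2)] by metis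
  then show ?thesis
    using diag_matrix_quadratic_lower[OF assms(1)] by (meson norm_ge_zero order_trans power_mono)
qed

text \<open>
  Used for an approximating function \<open>p\<close>, which is bounded because the sphere is compact.
\<close>

lemma nn_integral_sphere_square_finite:
  fixes p q :: "real ^ 'n \<Rightarrow> 'b::real_normed_vector"
  assumes cont: "continuous_on (sphere 0 1) p"
    and fin: "(\<integral>\<^sup>+ \<xi>. ennreal ((norm (p \<xi> - q \<xi>))\<^sup>2) \<partial>sphere_measure) < \<infinity>"
    and [measurable]: "(\<lambda>\<xi>. norm (p \<xi> - q \<xi>)) \<in> borel_measurable sphere_measure"
  shows "(\<integral>\<^sup>+ \<xi>. ennreal ((norm (q \<xi>))\<^sup>2) \<partial>sphere_measure) < \<infinity>"
proof -
  have "bounded (p ` sphere 0 1)"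
    by (intro compact_imp_bounded compact_continuous_image cont) simp
  then obtain M where "\<forall>y\<in>p ` sphere 0 1. norm y \<le> M"
    unfolding bounded_iff by blast
  then have M: "norm (p \<xi>) \<le> M" if "\<xi> \<in> sphere 0 1" for \<xi>
    using that by blast
  have "(\<integral>\<^sup>+ \<xi>. ennreal ((norm (q \<xi>))\<^sup>2) \<partial>sphere_measure) \<le>
      (\<integral>\<^sup>+ \<xi>. ennreal (2 * M\<^sup>2) + 2 * ennreal ((norm (p \<xi> - q \<xi>))\<^sup>2) \<partial>sphere_measure)"
  proof (rule nn_integral_mono)
    fix \<xi> :: "real ^ 'n" assume "\<xi> \<in> space sphere_measure"
    then have "norm (p \<xi>) \<le> M" by (intro M) (simp add: space_sphere_measure)
    then have "norm (q \<xi>) \<le> M + norm (p \<xi> - q \<xi>)"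
      using norm_triangle_sub[of "q \<xi>" "p \<xi>"] by (simp add: norm_minus_commute)
    then have "(norm (q \<xi>))\<^sup>2 \<le> (M + norm (p \<xi> - q \<xi>))\<^sup>2"
      by (intro power_mono) auto
    also have "\<dots> \<le> 2 * M\<^sup>2 + 2 * (norm (p \<xi> - q \<xi>))\<^sup>2"
      using sum_squares_bound[of M "norm (p \<xi> - q \<xi>)"] by (simp add: power2_sum)
    finally have "ennreal ((norm (q \<xi>))\<^sup>2) \<le> ennreal (2 * M\<^sup>2 + 2 * (norm (p \<xi> - q \<xi>))\<^sup>2)"
      by (rule ennreal_leI)
    then show "ennreal ((norm (q \<xi>))\<^sup>2) \<le> ennreal (2 * M\<^sup>2) + 2 * ennreal ((norm (p \<xi> - q \<xi>))\<^sup>2)"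
      by (simp add: ennreal_mult)
  qed
  also have "\<dots> = ennreal (2 * M\<^sup>2) * sphere_mass TYPE('n) +
      2 * (\<integral>\<^sup>+ \<xi>. ennreal ((norm (p \<xi> - q \<xi>))\<^sup>2) \<partial>sphere_measure)"
    by (simp add: nn_integral_add nn_integral_cmult space_sphere_measure)
  also have "\<dots> < \<infinity>"
    using fin sphere_mass_finite[where 'n='n] by (simp add: ennreal_mult_less_top less_top)
  finally show ?thesis .
qed

text \<open>
  Rayleigh quotients are formed with Bochner integrals, which vanish for functions that are not
  integrable. A lower bound for the quotient therefore depends on these facts.
\<close>

lemma has_sphere_gradient_square_integrable:
  fixes \<phi> :: "real ^ 'n \<Rightarrow> real"
  assumes "has_sphere_gradient \<phi> g"
  shows "integrable sphere_measure (\<lambda>\<xi>. (\<phi> \<xi>)\<^sup>2)" "integrable sphere_measure (\<lambda>\<xi>. (norm (g \<xi>))\<^sup>2)"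
proof -
  let ?S = "sphere_measure :: (real ^ 'n) measure"
  obtain f F where C1: "\<And>k::nat. C1_with_gradient (f k) (F k)"
    and lim_f: "(\<lambda>k. \<integral>\<^sup>+ \<xi>. ennreal ((f k \<xi> - \<phi> \<xi>)\<^sup>2) \<partial>?S) \<longlonglongrightarrow> 0"
    and lim_F: "(\<lambda>k. \<integral>\<^sup>+ \<xi>. ennreal ((norm (tangential_part \<xi> (F k \<xi>) - g \<xi>))\<^sup>2) \<partial>?S) \<longlonglongrightarrow> 0"
    and [measurable]: "\<phi> \<in> borel_measurable ?S" "g \<in> borel_measurable ?S"
    using assms unfolding has_sphere_gradient_def by blast
  have [measurable]: "f k \<in> borel_measurable ?S" "(\<lambda>\<xi>. tangential_part \<xi> (F k \<xi>)) \<in> borel_measurable ?S" for k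
    using C1_with_gradient_measurable[OF C1] by (auto intro: borel_measurable_sphere_measureI)
  have "eventually (\<lambda>k. (\<integral>\<^sup>+ \<xi>. ennreal ((f k \<xi> - \<phi> \<xi>)\<^sup>2) \<partial>?S) < \<infinity> \<and>
      (\<integral>\<^sup>+ \<xi>. ennreal ((norm (tangential_part \<xi> (F k \<xi>) - g \<xi>))\<^sup>2) \<partial>?S) < \<infinity>) sequentially"
    by (intro eventually_conj order_tendstoD(2)[OF lim_f] order_tendstoD(2)[OF lim_F]) auto
  then obtain k where k: "(\<integral>\<^sup>+ \<xi>. ennreal ((f k \<xi> - \<phi> \<xi>)\<^sup>2) \<partial>?S) < \<infinity>"
      "(\<integral>\<^sup>+ \<xi>. ennreal ((norm (tangential_part \<xi> (F k \<xi>) - g \<xi>))\<^sup>2) \<partial>?S) < \<infinity>"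
    using eventually_happens'[OF sequentially_bot] by blast
  have "isCont (f k) x" for x
    using C1[of k] unfolding C1_with_gradient_def gderiv_def by (meson has_derivative_continuous)
  then have cf: "continuous_on (sphere 0 1) (f k)"
    by (intro continuous_at_imp_continuous_on ballI)
  have "continuous_on (sphere 0 1) (F k)"
    by (rule continuous_on_subset[of UNIV]) (use C1[of k] in \<open>simp_all add: C1_with_gradient_def\<close>)
  then have cF: "continuous_on (sphere 0 1) (\<lambda>\<xi>. tangential_part \<xi> (F k \<xi>))"
    unfolding tangential_part_def by (intro continuous_intros)
  have "(\<integral>\<^sup>+ \<xi>. ennreal ((norm (\<phi> \<xi>))\<^sup>2) \<partial>?S) < \<infinity>"
    by (rule nn_integral_sphere_square_finite[OF cf]) (use k(1) in simp_all)
  then show "integrable ?S (\<lambda>\<xi>. (\<phi> \<xi>)\<^sup>2)"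
    by (intro integrableI_nonneg) simp_all
  have "(\<integral>\<^sup>+ \<xi>. ennreal ((norm (g \<xi>))\<^sup>2) \<partial>?S) < \<infinity>"
    by (rule nn_integral_sphere_square_finite[OF cF]) (use k(2) in simp_all)
  then show "integrable ?S (\<lambda>\<xi>. (norm (g \<xi>))\<^sup>2)"
    by (intro integrableI_nonneg) simp_all
qed

lemma measurable_matrix_vector_mult [measurable]:
  "(\<lambda>x. A *v x) \<in> borel_measurable borel" for A :: "real ^ 'n ^ 'm"
  by (intro borel_measurable_continuous_onI matrix_vector_mult_linear_continuous_on)

lemma measurable_identity_sphere_measure [measurable]: "(\<lambda>\<xi>. \<xi>) \<in> borel_measurable sphere_measure"
  by (rule borel_measurable_sphere_measureI) measurable

lemma integrable_weighted_square:
  fixes a :: "'n::finite \<Rightarrow> real"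
  assumes grad: "has_sphere_gradient \<phi> g" and a: "\<forall>i. 1 \<le> a i"
  shows "integrable sphere_measure (\<lambda>\<xi>. (\<phi> \<xi>)\<^sup>2 * mu_weight (diag_matrix a) \<xi>)"
proof -
  have [measurable]: "\<phi> \<in> borel_measurable sphere_measure"
    using grad by (simp add: has_sphere_gradient_def)
  define t where "t = Max (range a)"
  have t: "\<forall>i. a i \<le> t" by (simp add: t_def)
  have "integrable sphere_measure (\<lambda>\<xi>. t * (\<phi> \<xi>)\<^sup>2)"
    using has_sphere_gradient_square_integrable(1)[OF grad] by simp
  then show ?thesis
  proof (rule Bochner_Integration.integrable_bound)
    show "(\<lambda>\<xi>. (\<phi> \<xi>)\<^sup>2 * mu_weight (diag_matrix a) \<xi>) \<in> borel_measurable sphere_measure"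
      unfolding mu_weight_def by measurable
    show "AE \<xi> in sphere_measure. norm ((\<phi> \<xi>)\<^sup>2 * mu_weight (diag_matrix a) \<xi>) \<le> norm (t * (\<phi> \<xi>)\<^sup>2)"
    proof (rule AE_I2)
      fix \<xi> :: "real ^ 'n" assume "\<xi> \<in> space sphere_measure"
      then have "norm \<xi> = 1" by (simp add: space_sphere_measure)
      then have "1 \<le> mu_weight (diag_matrix a) \<xi>" "mu_weight (diag_matrix a) \<xi> \<le> t"
        using mu_weight_lower[OF a] mu_weight_upper[OF t] by auto
      then show "norm ((\<phi> \<xi>)\<^sup>2 * mu_weight (diag_matrix a) \<xi>) \<le> norm (t * (\<phi> \<xi>)\<^sup>2)"
        by (simp add: abs_mult mult.commute mult_right_mono)
    qed
  qed
qed

lemma integrable_energy: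
  fixes a :: "'n::finite \<Rightarrow> real"
  assumes grad: "has_sphere_gradient \<phi> g" and a: "\<forall>i. 1 \<le> a i"
  shows "integrable sphere_measure
    (\<lambda>\<xi>. (diag_matrix a *v theta_gradient (diag_matrix a) \<xi> (g \<xi>)) \<bullet> theta_gradient (diag_matrix a) \<xi> (g \<xi>))"
proof -
  have [measurable]: "g \<in> borel_measurable sphere_measure"
    using grad by (simp add: has_sphere_gradient_def)
  define t where "t = Max (range a)"
  have t: "\<forall>i. a i \<le> t" by (simp add: t_def)
  have "integrable sphere_measure (\<lambda>\<xi>. t * (norm (g \<xi>))\<^sup>2)"
    using has_sphere_gradient_square_integrable(2)[OF grad] by simp
  then show ?thesis
  proof (rule Bochner_Integration.integrable_bound)
    show "(\<lambda>\<xi>. (diag_matrix a *v theta_gradient (diag_matrix a) \<xi> (g \<xi>)) \<bullet> theta_gradient (diag_matrix a) \<xi> (g \<xi>))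
        \<in> borel_measurable sphere_measure"
      unfolding theta_gradient_def by measurable
    show "AE \<xi> in sphere_measure.
        norm ((diag_matrix a *v theta_gradient (diag_matrix a) \<xi> (g \<xi>)) \<bullet> theta_gradient (diag_matrix a) \<xi> (g \<xi>))
        \<le> norm (t * (norm (g \<xi>))\<^sup>2)"
    proof (rule AE_I2)
      fix \<xi> :: "real ^ 'n" assume "\<xi> \<in> space sphere_measure"
      then have 1: "norm \<xi> = 1" by (simp add: space_sphere_measure)
      let ?e = "(diag_matrix a *v theta_gradient (diag_matrix a) \<xi> (g \<xi>)) \<bullet> theta_gradient (diag_matrix a) \<xi> (g \<xi>)"
      have mu: "1 \<le> mu_weight (diag_matrix a) \<xi>"
        using mu_weight_lower[OF a 1] .
      \<comment> \<open>Positivity and the Pythagorean identity bound the energy by the quadratic form of the gradient.\<close>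
      have "0 \<le> ?e"
        using norm_tangential_part_le_quadratic_theta_gradient[OF a 1, of "g \<xi>"] by (meson order_trans zero_le_power2)
      moreover have "?e \<le> (diag_matrix a *v g \<xi>) \<bullet> g \<xi>"
        using mu by (subst diag_matrix_quadratic_theta_gradient) auto
      ultimately show "norm ?e \<le> norm (t * (norm (g \<xi>))\<^sup>2)"
        using diag_matrix_quadratic_upper[OF t, of "g \<xi>"] by (simp del: abs_mult)
    qed
  qed
qed

lemma rayleigh_quotient_nonneg:
  assumes a: "\<forall>i. 1 \<le> a i"
  shows "0 \<le> rayleigh_quotient (diag_matrix a) \<phi> g"
proof -
  have "0 \<le> (diag_matrix a *v x) \<bullet> x" for x
    using diag_matrix_quadratic_lower[OF a, of x] by (meson order_trans zero_le_power2)
  then show ?thesis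
    unfolding rayleigh_quotient_def mu_weight_def by (intro divide_nonneg_nonneg integral_nonneg) auto
qed

lemma lambda_sphere_nonneg:
  assumes "\<forall>i. 1 \<le> a i"
  shows "0 \<le> lambda_sphere (diag_matrix a) u"
  unfolding lambda_sphere_def using rayleigh_quotient_nonneg[OF assms] by (auto intro!: Inf_greatest)

lemma weighted_square_integral_pos:
  fixes a :: "'n::finite \<Rightarrow> real"
  assumes grad: "has_sphere_gradient \<phi> g" and a: "\<forall>i. 1 \<le> a i"
    and nz: "\<not> (AE \<xi> in sphere_measure. \<phi> \<xi> = 0)"
  shows "0 < (\<integral>\<xi>. (\<phi> \<xi>)\<^sup>2 * mu_weight (diag_matrix a) \<xi> \<partial>sphere_measure)"
proof -
  have mu: "1 \<le> mu_weight (diag_matrix a) \<xi>" if "\<xi> \<in> space sphere_measure" for \<xi> :: "real ^ 'n"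
    using that by (intro mu_weight_lower[OF a]) (simp add: space_sphere_measure)
  have nn: "AE \<xi> in sphere_measure. 0 \<le> (\<phi> \<xi>)\<^sup>2 * mu_weight (diag_matrix a) \<xi>"
    using mu by (intro AE_I2 mult_nonneg_nonneg) (auto intro: order_trans[of _ 1])
  have "(\<integral>\<xi>. (\<phi> \<xi>)\<^sup>2 * mu_weight (diag_matrix a) \<xi> \<partial>sphere_measure) \<noteq> 0"
  proof
    assume "(\<integral>\<xi>. (\<phi> \<xi>)\<^sup>2 * mu_weight (diag_matrix a) \<xi> \<partial>sphere_measure) = 0"
    then have "AE \<xi> in sphere_measure. (\<phi> \<xi>)\<^sup>2 * mu_weight (diag_matrix a) \<xi> = 0"
      using integral_nonneg_eq_0_iff_AE[OF integrable_weighted_square[OF grad a] nn] by blast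
    then have "AE \<xi> in sphere_measure. \<phi> \<xi> = 0"
      using AE_space by eventually_elim (use mu in fastforce)
    with nz show False by contradiction
  qed
  with integral_nonneg_AE[OF nn] show ?thesis by simp
qed

text \<open>
  The numerator dominates the energy of the tangential gradient, the denominator is at most \<open>t\<close>
  times the integral of \<open>\<phi>\<^sup>2\<close>, and the Poincare inequality compares the two.
\<close>

lemma rayleigh_quotient_ge:
  fixes a :: "'n::finite \<Rightarrow> real"
  assumes grad: "has_sphere_gradient \<phi> g" and N: "CARD('n) \<ge> 3"
    and a: "\<forall>i. 1 \<le> a i" and t: "\<forall>i. a i \<le> t"
    and nz: "\<not> (AE \<xi> in sphere_measure. \<phi> \<xi> = 0)"
    and half: "sphere_mass TYPE('n) \<le> 2 * emeasure sphere_measure {\<xi> \<in> sphere 0 1. \<phi> \<xi> = 0}"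
  shows "1 / (t * (384 * 2 ^ CARD('n))) \<le> rayleigh_quotient (diag_matrix a) \<phi> g"
proof -
  let ?S = "sphere_measure :: (real ^ 'n) measure"
  let ?A = "diag_matrix a"
  let ?K = "384 * 2 ^ CARD('n) :: real"
  let ?e = "\<lambda>\<xi>. (?A *v theta_gradient ?A \<xi> (g \<xi>)) \<bullet> theta_gradient ?A \<xi> (g \<xi>)"
  define E where "E = (\<integral>\<xi>. ?e \<xi> \<partial>?S)"
  define D where "D = (\<integral>\<xi>. (\<phi> \<xi>)\<^sup>2 * mu_weight ?A \<xi> \<partial>?S)"
  have [measurable]: "\<phi> \<in> borel_measurable ?S"
    using grad by (simp add: has_sphere_gradient_def)
  have sph: "norm \<xi> = 1" if "\<xi> \<in> space ?S" for \<xi>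
    using that by (simp add: space_sphere_measure)
  have t1: "1 \<le> t" using a t order_trans by (metis)
  have e_ge: "(norm (tangential_part \<xi> (g \<xi>)))\<^sup>2 \<le> ?e \<xi>" if "\<xi> \<in> space ?S" for \<xi>
    by (rule norm_tangential_part_le_quadratic_theta_gradient[OF a sph[OF that]])
  have e_nn: "0 \<le> ?e \<xi>" if "\<xi> \<in> space ?S" for \<xi>
    using e_ge[OF that] by (meson order_trans zero_le_power2)
  have D_pos: "0 < D"
    unfolding D_def by (rule weighted_square_integral_pos[OF grad a nz])
  have E_nn: "0 \<le> E"
    unfolding E_def by (intro integral_nonneg_AE AE_I2 e_nn)
  have "ennreal D = (\<integral>\<^sup>+ \<xi>. ennreal ((\<phi> \<xi>)\<^sup>2 * mu_weight ?A \<xi>) \<partial>?S)"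
    unfolding D_def using mu_weight_lower[OF a sph]
    by (intro nn_integral_eq_integral[symmetric] integrable_weighted_square[OF grad a] AE_I2 mult_nonneg_nonneg)
       (auto intro: order_trans[of _ 1])
  also have "\<dots> \<le> (\<integral>\<^sup>+ \<xi>. ennreal t * ennreal ((\<phi> \<xi>)\<^sup>2) \<partial>?S)"
  proof (rule nn_integral_mono)
    fix \<xi> assume "\<xi> \<in> space ?S"
    then have "(\<phi> \<xi>)\<^sup>2 * mu_weight ?A \<xi> \<le> (\<phi> \<xi>)\<^sup>2 * t"
      using mu_weight_upper[OF t sph] by (intro mult_left_mono) auto
    then show "ennreal ((\<phi> \<xi>)\<^sup>2 * mu_weight ?A \<xi>) \<le> ennreal t * ennreal ((\<phi> \<xi>)\<^sup>2)"
      using t1 by (subst ennreal_mult[symmetric]) (auto intro!: ennreal_leI simp: mult.commute)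
  qed
  also have "\<dots> = ennreal t * (\<integral>\<^sup>+ \<xi>. ennreal ((\<phi> \<xi>)\<^sup>2) \<partial>?S)"
    by (rule nn_integral_cmult) measurable
  also have "\<dots> \<le> ennreal t * (ennreal ?K * (\<integral>\<^sup>+ \<xi>. ennreal ((norm (tangential_part \<xi> (g \<xi>)))\<^sup>2) \<partial>?S))"
    by (intro mult_left_mono sphere_poincare_vanishing_on_half[OF grad N half]) auto
  also have "\<dots> \<le> ennreal t * (ennreal ?K * (\<integral>\<^sup>+ \<xi>. ennreal (?e \<xi>) \<partial>?S))"
    by (intro mult_left_mono nn_integral_mono ennreal_leI e_ge) auto
  also have "(\<integral>\<^sup>+ \<xi>. ennreal (?e \<xi>) \<partial>?S) = ennreal E"
    unfolding E_def by (intro nn_integral_eq_integral integrable_energy[OF grad a] AE_I2 e_nn)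
  also have "ennreal t * (ennreal ?K * ennreal E) = ennreal (t * (?K * E))"
    using t1 E_nn by (simp add: ennreal_mult)
  finally have "D \<le> t * (?K * E)"
    using t1 E_nn by (subst (asm) ennreal_le_iff) auto
  then have "1 / (t * ?K) \<le> E / D"
    using t1 D_pos by (simp add: field_simps)
  then show ?thesis by (simp add: rayleigh_quotient_def E_def D_def)
qed

text \<open>
  An admissible test function vanishes almost everywhere on the zero set of \<open>u\<close>.
\<close>

lemma lambda_sphere_ge:
  fixes a :: "'n::finite \<Rightarrow> real"
  assumes N: "CARD('n) \<ge> 3" and a: "\<forall>i. 1 \<le> a i" and t: "\<forall>i. a i \<le> t"
    and half: "sphere_mass TYPE('n) \<le> 2 * emeasure sphere_measure {\<xi> \<in> sphere 0 1. u \<xi> = 0}"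
  shows "ereal (1 / (t * (384 * 2 ^ CARD('n)))) \<le> lambda_sphere (diag_matrix a) u"
proof -
  have "1 / (t * (384 * 2 ^ CARD('n))) \<le> rayleigh_quotient (diag_matrix a) \<phi> g"
    if grad: "has_sphere_gradient \<phi> g" and nz: "\<not> (AE \<xi> in sphere_measure. \<phi> \<xi> = 0)"
      and null: "{\<xi> \<in> sphere 0 1. \<phi> \<xi> \<noteq> 0 \<and> u \<xi> = 0} \<in> null_sets sphere_measure" for \<phi> g
  proof (rule rayleigh_quotient_ge[OF grad N a t nz])
    have [measurable]: "\<phi> \<in> borel_measurable sphere_measure"
      using grad by (simp add: has_sphere_gradient_def)
    have Z: "{\<xi> \<in> sphere 0 1. \<phi> \<xi> = 0} \<in> sets sphere_measure"
      unfolding space_sphere_measure[symmetric] by measurable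
    have "emeasure sphere_measure {\<xi> \<in> sphere 0 1. u \<xi> = 0} \<le>
        emeasure sphere_measure ({\<xi> \<in> sphere 0 1. \<phi> \<xi> = 0} \<union> {\<xi> \<in> sphere 0 1. \<phi> \<xi> \<noteq> 0 \<and> u \<xi> = 0})"
      using Z null by (intro emeasure_mono) auto
    also have "\<dots> = emeasure sphere_measure {\<xi> \<in> sphere 0 1. \<phi> \<xi> = 0}"
      by (rule emeasure_Un_null_set[OF Z null])
    finally show "sphere_mass TYPE('n) \<le> 2 * emeasure sphere_measure {\<xi> \<in> sphere 0 1. \<phi> \<xi> = 0}"
      using half by (meson mult_left_mono order_trans zero_le)
  qed
  then show ?thesis
    unfolding lambda_sphere_def by (auto intro!: Inf_greatest)
qed

text \<open>
  The two zero sets cover the sphere up to a null set.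
\<close>

lemma zero_set_covers_half_sphere:
  fixes u v :: "real ^ 'n \<Rightarrow> real"
  assumes "u \<in> H1_sphere" "v \<in> H1_sphere"
    and int0: "(\<integral>\<^sup>+ \<xi>. ennreal ((u \<xi>)\<^sup>2 * (v \<xi>)\<^sup>2) \<partial>sphere_measure) = 0"
  obtains "sphere_mass TYPE('n) \<le> 2 * emeasure sphere_measure {\<xi> \<in> sphere 0 1. u \<xi> = 0}"
  | "sphere_mass TYPE('n) \<le> 2 * emeasure sphere_measure {\<xi> \<in> sphere 0 1. v \<xi> = 0}"
proof -
  let ?S = "sphere_measure :: (real ^ 'n) measure"
  have [measurable]: "u \<in> borel_measurable ?S" "v \<in> borel_measurable ?S"
    using assms(1,2) by (auto simp: H1_sphere_def has_sphere_gradient_def)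
  define U where "U = {\<xi> \<in> space ?S. u \<xi> = 0}"
  define V where "V = {\<xi> \<in> space ?S. v \<xi> = 0}"
  have [measurable]: "U \<in> sets ?S" "V \<in> sets ?S"
    unfolding U_def V_def by measurable
  have "AE \<xi> in ?S. ennreal ((u \<xi>)\<^sup>2 * (v \<xi>)\<^sup>2) = 0"
    using int0 by (subst (asm) nn_integral_0_iff_AE) auto
  then have "AE \<xi> in ?S. \<xi> \<in> U \<union> V"
    using AE_space by eventually_elim (auto simp: U_def V_def ennreal_eq_0_iff mult_le_0_iff)
  then have "emeasure ?S (U \<union> V) = emeasure ?S (space ?S)"
    by (intro emeasure_eq_AE) auto
  then have "sphere_mass TYPE('n) \<le> emeasure ?S U + emeasure ?S V"
    using emeasure_subadditive[of U ?S V] by (simp add: space_sphere_measure)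
  moreover have "x + y \<le> 2 * y" if "x \<le> y" for x y :: ennreal
    using that by (simp add: mult_2 add_right_mono)
  ultimately have "sphere_mass TYPE('n) \<le> 2 * emeasure ?S U \<or> sphere_mass TYPE('n) \<le> 2 * emeasure ?S V"
    by (metis add.commute linear order_trans)
  then show ?thesis
    using that by (auto simp: U_def V_def space_sphere_measure)
qed

section \<open>The positive part of a coordinate as a test function\<close>

text \<open>
  A \<open>C\<^sup>1\<close> approximation of the positive part that is uniformly \<open>\<epsilon>\<close>-close and has derivative exactly
  0 on the closed negative half line. Its derivative thus converges everywhere, including at 0,
  to the indicator of the open positive half line, and the equator needs no special treatment.
\<close>

definition smooth_pos_part :: "real \<Rightarrow> real \<Rightarrow> real" where
  "smooth_pos_part \<epsilon> t = sqrt ((max t 0)\<^sup>2 + \<epsilon>\<^sup>2) - \<epsilon>"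

definition smooth_pos_part_deriv :: "real \<Rightarrow> real \<Rightarrow> real" where
  "smooth_pos_part_deriv \<epsilon> t = max t 0 / sqrt ((max t 0)\<^sup>2 + \<epsilon>\<^sup>2)"

lemma DERIV_square_pos_part: "((\<lambda>t::real. (max t 0)\<^sup>2) has_field_derivative 2 * max t 0) (at t)"
proof -
  consider "t > 0" | "t < 0" | "t = 0" by linarith
  then show ?thesis
  proof cases
    case 1
    have "((\<lambda>t::real. t\<^sup>2) has_field_derivative 2 * max t 0) (at t)"
      using 1 by (auto intro!: derivative_eq_intros)
    then show ?thesis
      by (rule has_field_derivative_transform_within_open[of _ _ _ "{0<..}"]) (use 1 in auto)
  next
    case 2
    have "((\<lambda>t::real. 0) has_field_derivative 2 * max t 0) (at t)"
      using 2 by (auto intro!: derivative_eq_intros)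
    then show ?thesis
      by (rule has_field_derivative_transform_within_open[of _ _ _ "{..<0}"]) (use 2 in auto)
  next
    case 3
    have "((\<lambda>h::real. (max h 0)\<^sup>2 / h) \<longlongrightarrow> 0) (at 0)"
    proof (rule Lim_null_comparison)
      show "eventually (\<lambda>h::real. norm ((max h 0)\<^sup>2 / h) \<le> \<bar>h\<bar>) (at 0)"
        by (rule always_eventually) (auto simp: max_def power2_eq_square)
      show "((\<lambda>h::real. \<bar>h\<bar>) \<longlongrightarrow> 0) (at 0)"
        by (intro tendsto_rabs_zero tendsto_ident_at)
    qed
    then show ?thesis using 3 by (simp add: DERIV_def)
  qed
qed

lemma DERIV_smooth_pos_part:
  assumes "\<epsilon> > 0"
  shows "(smooth_pos_part \<epsilon> has_field_derivative smooth_pos_part_deriv \<epsilon> t) (at t)"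
proof -
  have pos: "0 < (max t 0)\<^sup>2 + \<epsilon>\<^sup>2"
    using assms by (simp add: add_nonneg_pos)
  have "((\<lambda>t. (max t 0)\<^sup>2 + \<epsilon>\<^sup>2) has_field_derivative 2 * max t 0) (at t)"
    using DERIV_add[OF DERIV_square_pos_part DERIV_const] by simp
  from DERIV_diff[OF DERIV_chain2[OF DERIV_real_sqrt[OF pos] this] DERIV_const[of \<epsilon>]]
  show ?thesis
    unfolding smooth_pos_part_def[abs_def] smooth_pos_part_deriv_def by (simp add: field_simps)
qed

lemma smooth_pos_part_error:
  assumes "\<epsilon> > 0"
  shows "\<bar>smooth_pos_part \<epsilon> t - max t 0\<bar> \<le> \<epsilon>"
proof -
  have "max t 0 \<le> sqrt ((max t 0)\<^sup>2 + \<epsilon>\<^sup>2)"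
    by (intro real_le_rsqrt) simp
  moreover have "sqrt ((max t 0)\<^sup>2 + \<epsilon>\<^sup>2) \<le> max t 0 + \<epsilon>"
    using assms by (intro real_le_lsqrt) (auto simp: power2_sum)
  ultimately show ?thesis
    unfolding smooth_pos_part_def by linarith
qed

lemma smooth_pos_part_deriv_range:
  assumes "\<epsilon> > 0"
  shows "0 \<le> smooth_pos_part_deriv \<epsilon> t" "smooth_pos_part_deriv \<epsilon> t \<le> 1"
proof -
  have "max t 0 \<le> sqrt ((max t 0)\<^sup>2 + \<epsilon>\<^sup>2)"
    by (intro real_le_rsqrt) simp
  then show "0 \<le> smooth_pos_part_deriv \<epsilon> t" "smooth_pos_part_deriv \<epsilon> t \<le> 1"
    using assms by (auto simp: smooth_pos_part_deriv_def divide_le_eq_1 add_nonneg_pos)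
qed

lemma smooth_pos_part_deriv_nonpos: "t \<le> 0 \<Longrightarrow> smooth_pos_part_deriv \<epsilon> t = 0"
  by (simp add: smooth_pos_part_deriv_def)

lemma smooth_pos_part_deriv_tendsto:
  assumes "t > 0"
  shows "(\<lambda>k. smooth_pos_part_deriv (1 / real (Suc k)) t) \<longlonglongrightarrow> 1"
proof -
  have "(\<lambda>k. max t 0 / sqrt ((max t 0)\<^sup>2 + (1 / real (Suc k))\<^sup>2)) \<longlonglongrightarrow> max t 0 / sqrt ((max t 0)\<^sup>2 + 0\<^sup>2)"
    using assms LIMSEQ_Suc[OF lim_1_over_n] by (intro tendsto_intros) auto
  then show ?thesis
    using assms by (simp add: smooth_pos_part_deriv_def)
qed

lemma C1_with_gradient_smooth_pos_part:
  assumes "\<epsilon> > 0"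
  shows "C1_with_gradient (\<lambda>x. smooth_pos_part \<epsilon> (e \<bullet> x)) (\<lambda>x. smooth_pos_part_deriv \<epsilon> (e \<bullet> x) *\<^sub>R e)"
  unfolding C1_with_gradient_def
proof (intro conjI allI)
  fix x
  have "GDERIV (\<lambda>x. e \<bullet> x) x :> e"
    unfolding gderiv_def by (auto intro!: derivative_eq_intros simp: inner_commute)
  then show "GDERIV (\<lambda>x. smooth_pos_part \<epsilon> (e \<bullet> x)) x :> smooth_pos_part_deriv \<epsilon> (e \<bullet> x) *\<^sub>R e"
    using DERIV_smooth_pos_part[OF assms] by (rule GDERIV_DERIV_compose)
next
  have "sqrt ((max (e \<bullet> x) 0)\<^sup>2 + \<epsilon>\<^sup>2) \<noteq> 0" for x
    using assms by (simp add: add_nonneg_eq_0_iff)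
  then show "continuous_on UNIV (\<lambda>x. smooth_pos_part_deriv \<epsilon> (e \<bullet> x) *\<^sub>R e)"
    unfolding smooth_pos_part_deriv_def by (intro continuous_intros ballI)
qed

text \<open>
  The values converge uniformly, the gradients pointwise with the bound 1.
\<close>

lemma has_sphere_gradient_pos_part:
  fixes e :: "real ^ 'n"
  assumes e: "norm e = 1"
  shows "has_sphere_gradient (\<lambda>\<xi>. max (e \<bullet> \<xi>) 0) (\<lambda>\<xi>. if e \<bullet> \<xi> > 0 then tangential_part \<xi> e else 0)"
proof -
  let ?S = "sphere_measure :: (real ^ 'n) measure"
  let ?g = "\<lambda>\<xi>. if e \<bullet> \<xi> > 0 then tangential_part \<xi> e else 0"
  define \<epsilon> where "\<epsilon> k = 1 / real (Suc k)" for k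
  define f where "f k x = smooth_pos_part (\<epsilon> k) (e \<bullet> x)" for k x
  define h where "h k x = smooth_pos_part_deriv (\<epsilon> k) (e \<bullet> x)" for k x
  define F where "F k x = h k x *\<^sub>R e" for k x
  have \<epsilon>: "\<epsilon> k > 0" for k by (simp add: \<epsilon>_def)
  have C1: "C1_with_gradient (f k) (F k)" for k
    unfolding f_def[abs_def] F_def[abs_def] h_def[abs_def] by (rule C1_with_gradient_smooth_pos_part[OF \<epsilon>])
  have [measurable]: "f k \<in> borel_measurable ?S" "(\<lambda>\<xi>. tangential_part \<xi> (F k \<xi>)) \<in> borel_measurable ?S" for k
    using C1_with_gradient_measurable[OF C1] by (auto intro: borel_measurable_sphere_measureI)
  have [measurable]: "(\<lambda>\<xi>. max (e \<bullet> \<xi>) 0) \<in> borel_measurable ?S"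
    by measurable
  have [measurable]: "?g \<in> borel_measurable ?S"
    unfolding tangential_part_def by measurable
  have lim_f: "(\<lambda>k. \<integral>\<^sup>+ \<xi>. ennreal ((f k \<xi> - max (e \<bullet> \<xi>) 0)\<^sup>2) \<partial>?S) \<longlonglongrightarrow> 0"
  proof (rule tendsto_sandwich)
    show "eventually (\<lambda>k. 0 \<le> (\<integral>\<^sup>+ \<xi>. ennreal ((f k \<xi> - max (e \<bullet> \<xi>) 0)\<^sup>2) \<partial>?S)) sequentially"
      by simp
    show "eventually (\<lambda>k. (\<integral>\<^sup>+ \<xi>. ennreal ((f k \<xi> - max (e \<bullet> \<xi>) 0)\<^sup>2) \<partial>?S)
        \<le> sphere_mass TYPE('n) * ennreal ((\<epsilon> k)\<^sup>2)) sequentially"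
    proof (intro always_eventually allI)
      fix k
      have "(f k \<xi> - max (e \<bullet> \<xi>) 0)\<^sup>2 \<le> (\<epsilon> k)\<^sup>2" for \<xi>
        using power_mono[OF smooth_pos_part_error[OF \<epsilon>[of k], of "e \<bullet> \<xi>"], of 2] by (simp add: f_def)
      then have "(\<integral>\<^sup>+ \<xi>. ennreal ((f k \<xi> - max (e \<bullet> \<xi>) 0)\<^sup>2) \<partial>?S) \<le> (\<integral>\<^sup>+ \<xi>. ennreal ((\<epsilon> k)\<^sup>2) \<partial>?S)"
        by (intro nn_integral_mono ennreal_leI)
      then show "(\<integral>\<^sup>+ \<xi>. ennreal ((f k \<xi> - max (e \<bullet> \<xi>) 0)\<^sup>2) \<partial>?S) \<le> sphere_mass TYPE('n) * ennreal ((\<epsilon> k)\<^sup>2)"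
        by (simp add: space_sphere_measure mult.commute)
    qed
    have "(\<lambda>k. (\<epsilon> k)\<^sup>2) \<longlonglongrightarrow> 0\<^sup>2"
      unfolding \<epsilon>_def by (intro tendsto_power LIMSEQ_Suc[OF lim_1_over_n])
    then have "(\<lambda>k. ennreal ((\<epsilon> k)\<^sup>2)) \<longlonglongrightarrow> ennreal 0"
      by (intro tendsto_ennrealI) simp
    then have "(\<lambda>k. sphere_mass TYPE('n) * ennreal ((\<epsilon> k)\<^sup>2)) \<longlonglongrightarrow> sphere_mass TYPE('n) * ennreal 0"
      using sphere_mass_finite[where 'n='n] by (intro ennreal_tendsto_cmult) (simp_all add: less_top)
    then show "(\<lambda>k. sphere_mass TYPE('n) * ennreal ((\<epsilon> k)\<^sup>2)) \<longlonglongrightarrow> 0"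
      by simp
  qed simp
  have "(\<lambda>k. \<integral>\<^sup>+ \<xi>. ennreal ((norm (tangential_part \<xi> (F k \<xi>) - ?g \<xi>))\<^sup>2) \<partial>?S) \<longlonglongrightarrow> (\<integral>\<^sup>+ \<xi>. 0 \<partial>?S)"
  proof (rule nn_integral_dominated_convergence[where w = "\<lambda>_. 1"])
    have diff: "tangential_part \<xi> (F k \<xi>) - ?g \<xi> = (h k \<xi> - (if e \<bullet> \<xi> > 0 then 1 else 0)) *\<^sub>R tangential_part \<xi> e" for k \<xi>
      by (simp add: tangential_part_def F_def algebra_simps)
    show "AE \<xi> in ?S. ennreal ((norm (tangential_part \<xi> (F k \<xi>) - ?g \<xi>))\<^sup>2) \<le> 1" for k
    proof (rule AE_I2)
      fix \<xi> assume "\<xi> \<in> space ?S"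
      then have 1: "norm \<xi> = 1" by (simp add: space_sphere_measure)
      have "\<bar>h k \<xi> - (if e \<bullet> \<xi> > 0 then 1 else 0)\<bar> \<le> 1"
        using smooth_pos_part_deriv_range[OF \<epsilon>[of k], of "e \<bullet> \<xi>"] by (auto simp: h_def)
      moreover have "norm (tangential_part \<xi> e) \<le> 1"
        using norm_tangential_part_le[OF 1, of e] e by simp
      ultimately have "norm (tangential_part \<xi> (F k \<xi>) - ?g \<xi>) \<le> 1"
        unfolding diff norm_scaleR by (intro mult_le_one) auto
      then have "(norm (tangential_part \<xi> (F k \<xi>) - ?g \<xi>))\<^sup>2 \<le> 1"
        by (simp add: power_le_one)
      then show "ennreal ((norm (tangential_part \<xi> (F k \<xi>) - ?g \<xi>))\<^sup>2) \<le> 1"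
        using ennreal_leI[of _ 1] by simp
    qed
    show "(\<integral>\<^sup>+ \<xi>. 1 \<partial>?S) < \<infinity>"
      using sphere_mass_finite[where 'n='n] by (simp add: space_sphere_measure less_top)
    show "AE \<xi> in ?S. (\<lambda>k. ennreal ((norm (tangential_part \<xi> (F k \<xi>) - ?g \<xi>))\<^sup>2)) \<longlonglongrightarrow> 0"
    proof (rule AE_I2)
      fix \<xi> :: "real ^ 'n"
      have "(\<lambda>k. h k \<xi>) \<longlonglongrightarrow> (if e \<bullet> \<xi> > 0 then 1 else 0)"
        using smooth_pos_part_deriv_tendsto[of "e \<bullet> \<xi>"] smooth_pos_part_deriv_nonpos[of "e \<bullet> \<xi>"]
        by (auto simp: h_def \<epsilon>_def)
      then have "(\<lambda>k. h k \<xi> - (if e \<bullet> \<xi> > 0 then 1 else 0)) \<longlonglongrightarrow> 0"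
        by (simp add: LIM_zero)
      then have "(\<lambda>k. ennreal ((norm ((h k \<xi> - (if e \<bullet> \<xi> > 0 then 1 else 0)) *\<^sub>R tangential_part \<xi> e))\<^sup>2))
          \<longlonglongrightarrow> ennreal ((norm (0 *\<^sub>R tangential_part \<xi> e))\<^sup>2)"
        by (intro tendsto_ennrealI tendsto_power tendsto_norm tendsto_scaleR tendsto_const)
      then show "(\<lambda>k. ennreal ((norm (tangential_part \<xi> (F k \<xi>) - ?g \<xi>))\<^sup>2)) \<longlonglongrightarrow> 0"
        unfolding diff by simp
    qed
  qed measurable
  then have lim_F: "(\<lambda>k. \<integral>\<^sup>+ \<xi>. ennreal ((norm (tangential_part \<xi> (F k \<xi>) - ?g \<xi>))\<^sup>2) \<partial>?S) \<longlonglongrightarrow> 0"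
    by simp
  show ?thesis
    unfolding has_sphere_gradient_def
    using C1 lim_f lim_F by (intro conjI exI[of _ f] exI[of _ F]) auto
qed

text \<open>
  The antipodal map exchanges the two half spheres, so each carries half of the second moment.
\<close>

lemma half_sphere_second_moment:
  fixes e :: "real ^ 'n"
  assumes e: "e = axis i 1 \<or> e = - axis i 1"
  shows "2 * real CARD('n) * (\<integral>\<xi>. (max (e \<bullet> \<xi>) 0)\<^sup>2 \<partial>sphere_measure) = measure (sphere_measure :: (real ^ 'n) measure) (sphere 0 1)"
proof -
  let ?S = "sphere_measure :: (real ^ 'n) measure"
  let ?P = "\<integral>\<^sup>+ \<xi>. ennreal ((max (e \<bullet> \<xi>) 0)\<^sup>2) \<partial>?S"
  define P where "P = (\<integral>\<xi>. (max (e \<bullet> \<xi>) 0)\<^sup>2 \<partial>?S)"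
  have e1: "norm e = 1" using e by auto
  have P: "?P = ennreal P"
    unfolding P_def
    by (intro nn_integral_eq_integral has_sphere_gradient_square_integrable(1)[OF has_sphere_gradient_pos_part[OF e1]]) simp
  have "(\<integral>\<^sup>+ \<xi>. ennreal ((max (e \<bullet> (- \<xi>)) 0)\<^sup>2) \<partial>?S) = ?P"
    by (rule nn_integral_sphere_measure_uminus) measurable
  then have "2 * ?P = ?P + (\<integral>\<^sup>+ \<xi>. ennreal ((max (e \<bullet> (- \<xi>)) 0)\<^sup>2) \<partial>?S)"
    by (simp add: mult_2)
  also have "\<dots> = (\<integral>\<^sup>+ \<xi>. ennreal ((max (e \<bullet> \<xi>) 0)\<^sup>2) + ennreal ((max (e \<bullet> (- \<xi>)) 0)\<^sup>2) \<partial>?S)"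
    by (rule nn_integral_add[symmetric]) measurable
  also have "\<dots> = (\<integral>\<^sup>+ \<xi>. ennreal ((\<xi> $ i)\<^sup>2) \<partial>?S)"
  proof (rule nn_integral_cong)
    fix \<xi> :: "real ^ 'n"
    have "(e \<bullet> \<xi>)\<^sup>2 = (\<xi> $ i)\<^sup>2"
      using e by (auto simp: inner_axis')
    then show "ennreal ((max (e \<bullet> \<xi>) 0)\<^sup>2) + ennreal ((max (e \<bullet> (- \<xi>)) 0)\<^sup>2) = ennreal ((\<xi> $ i)\<^sup>2)"
      by (cases "e \<bullet> \<xi> \<ge> 0") (simp_all add: max_def)
  qed
  finally have "of_nat CARD('n) * (2 * ?P) = sphere_mass TYPE('n)"
    by (simp add: nn_integral_sphere_coordinate_squared)
  moreover have "0 \<le> P" by (simp add: P_def)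
  moreover from this have "of_nat CARD('n) * (2 * ennreal P) = ennreal (real CARD('n) * (2 * P))"
    by (simp add: ennreal_mult ennreal_of_nat_eq_real_of_nat)
  ultimately have "ennreal (2 * real CARD('n) * P) = sphere_mass TYPE('n)"
    unfolding P by (simp only: mult_ac)
  with \<open>0 \<le> P\<close> have "2 * real CARD('n) * P = measure ?S (sphere 0 1)"
    by (simp add: measure_def) (metis enn2real_ennreal mult_nonneg_nonneg of_nat_0_le_iff zero_le_numeral)
  then show ?thesis by (simp add: P_def)
qed

text \<open>
  The half sphere and its antipodal image are disjoint and have the same measure.
\<close>

lemma measure_half_sphere_le:
  fixes e :: "real ^ 'n"
  shows "2 * measure sphere_measure {\<xi> \<in> sphere 0 1. e \<bullet> \<xi> > 0}
    \<le> measure (sphere_measure :: (real ^ 'n) measure) (sphere 0 1)"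
proof -
  let ?S = "sphere_measure :: (real ^ 'n) measure"
  interpret finite_measure ?S by simp
  define H where "H = {\<xi> \<in> space ?S. e \<bullet> \<xi> > 0}"
  define K where "K = {\<xi> \<in> space ?S. e \<bullet> (- \<xi>) > 0}"
  have [measurable]: "H \<in> sets ?S" "K \<in> sets ?S"
    unfolding H_def K_def by measurable
  let ?k = "\<lambda>\<xi>. if e \<bullet> \<xi> > 0 then 1 else 0 :: ennreal"
  have "emeasure ?S K = (\<integral>\<^sup>+ \<xi>. indicator K \<xi> \<partial>?S)"
    by simp
  also have "\<dots> = (\<integral>\<^sup>+ \<xi>. ?k (- \<xi>) \<partial>?S)"
    by (intro nn_integral_cong) (simp add: K_def indicator_def)
  also have "\<dots> = (\<integral>\<^sup>+ \<xi>. ?k \<xi> \<partial>?S)"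
    by (rule nn_integral_sphere_measure_uminus) measurable
  also have "\<dots> = (\<integral>\<^sup>+ \<xi>. indicator H \<xi> \<partial>?S)"
    by (intro nn_integral_cong) (simp add: H_def indicator_def)
  also have "\<dots> = emeasure ?S H"
    by simp
  finally have "measure ?S K = measure ?S H"
    by (simp add: measure_def)
  moreover have "measure ?S (H \<union> K) = measure ?S H + measure ?S K"
    by (rule finite_measure_Union) (auto simp: H_def K_def)
  moreover have "measure ?S (H \<union> K) \<le> measure ?S (space ?S)"
    by (rule bounded_measure)
  ultimately show ?thesis
    by (simp add: H_def space_sphere_measure)
qed

text \<open>
  Let \<open>P\<close> be the second moment of the half sphere. On the half sphere the energy density is
  \<open>1 - \<langle>e, \<xi>\<rangle>\<^sup>2 / \<mu>\<close>, which integrates to at most \<open>N P - P / t\<close>, while the denominator is at least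
  \<open>P\<close>. For the identity matrix and \<open>t = 1\<close> the bound is \<open>N - 1\<close>, the first eigenvalue of the half
  sphere.
\<close>

lemma rayleigh_quotient_pos_part_le:
  fixes a :: "'n::finite \<Rightarrow> real"
  assumes e: "e = axis i 1 \<or> e = - axis i 1" and ai: "a i = 1"
    and a: "\<forall>j. 1 \<le> a j" and t: "\<forall>j. a j \<le> t"
  shows "rayleigh_quotient (diag_matrix a) (\<lambda>\<xi>. max (e \<bullet> \<xi>) 0)
      (\<lambda>\<xi>. if e \<bullet> \<xi> > 0 then tangential_part \<xi> e else 0) \<le> real CARD('n) - 1 / t"
proof -
  let ?S = "sphere_measure :: (real ^ 'n) measure"
  let ?A = "diag_matrix a"
  let ?\<phi> = "\<lambda>\<xi>. max (e \<bullet> \<xi>) 0"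
  let ?g = "\<lambda>\<xi>. if e \<bullet> \<xi> > 0 then tangential_part \<xi> e else 0"
  let ?H = "{\<xi> \<in> sphere 0 1. e \<bullet> \<xi> > 0}"
  interpret finite_measure ?S by simp
  have e1: "norm e = 1" using e by auto
  have grad: "has_sphere_gradient ?\<phi> ?g"
    by (rule has_sphere_gradient_pos_part[OF e1])
  define P where "P = (\<integral>\<xi>. (?\<phi> \<xi>)\<^sup>2 \<partial>?S)"
  define M where "M = measure ?S (sphere 0 1)"
  define D where "D = (\<integral>\<xi>. (?\<phi> \<xi>)\<^sup>2 * mu_weight ?A \<xi> \<partial>?S)"
  define E where "E = (\<integral>\<xi>. (?A *v theta_gradient ?A \<xi> (?g \<xi>)) \<bullet> theta_gradient ?A \<xi> (?g \<xi>) \<partial>?S)"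
  have P_int: "integrable ?S (\<lambda>\<xi>. (?\<phi> \<xi>)\<^sup>2)"
    by (rule has_sphere_gradient_square_integrable(1)[OF grad])
  have PM: "2 * real CARD('n) * P = M"
    unfolding P_def M_def by (rule half_sphere_second_moment[OF e])
  have M_pos: "0 < M"
    unfolding M_def by (rule measure_sphere_pos)
  have P_pos: "0 < P"
    using PM M_pos by (metis mult_nonneg_nonpos not_le of_nat_0_le_iff mult_nonneg_nonneg zero_le_numeral)
  have t1: "1 \<le> t" using a t order_trans by metis
  have Ae: "?A *v e = e"
    using e ai by (auto simp: diag_matrix_vector_mult vec_eq_iff axis_def)
  have H [measurable]: "?H \<in> sets ?S"
    unfolding space_sphere_measure[symmetric] by measurable
  have H_int: "integrable ?S (indicator ?H :: _ \<Rightarrow> real)"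
    by (intro integrable_real_indicator H) (simp add: emeasure_finite top.not_eq_extremum[symmetric])
  have "P \<le> D"
    unfolding P_def D_def
  proof (rule integral_mono[OF P_int integrable_weighted_square[OF grad a]])
    fix \<xi> assume "\<xi> \<in> space ?S"
    then have "1 \<le> mu_weight ?A \<xi>"
      by (intro mu_weight_lower[OF a]) (simp add: space_sphere_measure)
    then show "(?\<phi> \<xi>)\<^sup>2 \<le> (?\<phi> \<xi>)\<^sup>2 * mu_weight ?A \<xi>"
      by (simp add: mult_le_cancel_left1)
  qed
  have "E \<le> (\<integral>\<xi>. indicator ?H \<xi> - (?\<phi> \<xi>)\<^sup>2 / t \<partial>?S)"
    unfolding E_def
  proof (rule integral_mono[OF integrable_energy[OF grad a]])
    show "integrable ?S (\<lambda>\<xi>. indicator ?H \<xi> - (?\<phi> \<xi>)\<^sup>2 / t)"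
      by (intro Bochner_Integration.integrable_diff integrable_divide P_int H_int)
    fix \<xi> assume "\<xi> \<in> space ?S"
    then have 1: "norm \<xi> = 1" by (simp add: space_sphere_measure)
    have mu: "1 \<le> mu_weight ?A \<xi>" "mu_weight ?A \<xi> \<le> t"
      using mu_weight_lower[OF a 1] mu_weight_upper[OF t 1] .
    show "(?A *v theta_gradient ?A \<xi> (?g \<xi>)) \<bullet> theta_gradient ?A \<xi> (?g \<xi>) \<le> indicator ?H \<xi> - (?\<phi> \<xi>)\<^sup>2 / t"
    proof (cases "e \<bullet> \<xi> > 0")
      case True
      have th: "theta_gradient ?A \<xi> (tangential_part \<xi> e) = theta_gradient ?A \<xi> e"
        using mu by (simp add: theta_gradient_def tangential_part_def mu_weight_def matrix_vector_mult_diff_distrib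
            matrix_vector_mult_scaleR inner_diff_left diff_divide_distrib scaleR_diff_left)
      have "(?A *v theta_gradient ?A \<xi> e) \<bullet> theta_gradient ?A \<xi> e = 1 - (e \<bullet> \<xi>)\<^sup>2 / mu_weight ?A \<xi>"
        using mu e1 by (subst diag_matrix_quadratic_theta_gradient) (auto simp: Ae norm_eq_1)
      also have "\<dots> \<le> 1 - (e \<bullet> \<xi>)\<^sup>2 / t"
        using mu by (intro diff_left_mono divide_left_mono) (auto intro: mult_pos_pos)
      finally show ?thesis
        using True 1 by (simp add: th)
    next
      case False
      then show ?thesis by (simp add: theta_gradient_def)
    qed
  qed
  also have "\<dots> = (\<integral>\<xi>. indicator ?H \<xi> \<partial>?S) - (\<integral>\<xi>. (?\<phi> \<xi>)\<^sup>2 / t \<partial>?S)"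
    by (intro Bochner_Integration.integral_diff integrable_divide P_int H_int)
  also have "\<dots> = measure ?S ?H - P / t"
    using sets.sets_into_space[OF H] by (simp add: P_def Int_absorb2)
  also have "\<dots> \<le> real CARD('n) * P - P / t"
    using measure_half_sphere_le[of e] PM by (simp add: M_def)
  finally have "E \<le> (real CARD('n) - 1 / t) * P"
    by (simp add: algebra_simps)
  also have "\<dots> \<le> (real CARD('n) - 1 / t) * D"
  proof (intro mult_left_mono \<open>P \<le> D\<close>)
    have "1 / t \<le> 1" using t1 by simp
    moreover have "1 \<le> real CARD('n)" by (simp add: Suc_le_eq)
    ultimately show "0 \<le> real CARD('n) - 1 / t" by linarith
  qed
  finally show ?thesis
    using P_pos \<open>P \<le> D\<close> by (simp add: rayleigh_quotient_def E_def D_def divide_le_eq)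
qed

lemma lambda_sphere_pos_part_le:
  fixes a :: "'n::finite \<Rightarrow> real"
  assumes e: "e = axis i 1 \<or> e = - axis i 1" and ai: "a i = 1"
    and a: "\<forall>j. 1 \<le> a j" and t: "\<forall>j. a j \<le> t"
  shows "lambda_sphere (diag_matrix a) (\<lambda>\<xi>. max (e \<bullet> \<xi>) 0) \<le> ereal (real CARD('n) - 1 / t)"
proof -
  let ?S = "sphere_measure :: (real ^ 'n) measure"
  let ?\<phi> = "\<lambda>\<xi>. max (e \<bullet> \<xi>) 0"
  let ?g = "\<lambda>\<xi>. if e \<bullet> \<xi> > 0 then tangential_part \<xi> e else 0"
  have e1: "norm e = 1" using e by auto
  have nz: "\<not> (AE \<xi> in ?S. ?\<phi> \<xi> = 0)"
  proof
    assume "AE \<xi> in ?S. ?\<phi> \<xi> = 0"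
    then have "(\<integral>\<xi>. (?\<phi> \<xi>)\<^sup>2 \<partial>?S) = 0"
      by (intro integral_eq_zero_AE) auto
    then have "measure ?S (sphere 0 1) = 0"
      using half_sphere_second_moment[OF e] by simp
    then show False
      using measure_sphere_pos[where 'n='n] by simp
  qed
  have "lambda_sphere (diag_matrix a) ?\<phi> \<le> ereal (rayleigh_quotient (diag_matrix a) ?\<phi> ?g)"
    unfolding lambda_sphere_def using nz has_sphere_gradient_pos_part[OF e1]
    by (auto intro!: Inf_lower exI[of _ ?\<phi>] exI[of _ ?g])
  also have "\<dots> \<le> ereal (real CARD('n) - 1 / t)"
    using rayleigh_quotient_pos_part_le[where a=a and e=e, OF e ai a t] by simp
  finally show ?thesis .
qed

section \<open>The two bounds for the infimum\<close>

lemma gamma_fun_mono: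
  assumes "0 \<le> s" "s \<le> t"
  shows "gamma_fun N s \<le> gamma_fun N t"
proof (cases "t = \<infinity>")
  case False
  with assms obtain r q where "s = ereal r" "t = ereal q" "0 \<le> r" "r \<le> q"
    by (cases s; cases t) auto
  then show ?thesis by (simp add: gamma_fun_def)
qed (simp add: gamma_fun_def)

lemma gamma_fun_ereal:
  "gamma_fun N (ereal r) = ereal (sqrt (((real N - 2) / 2)\<^sup>2 + r) - (real N - 2) / 2)"
  by (simp add: gamma_fun_def)

lemma gamma_fun_pos:
  assumes "0 < c" "N \<ge> 2"
  shows "0 < gamma_fun N (ereal c)"
proof -
  have "(real N - 2) / 2 < sqrt (((real N - 2) / 2)\<^sup>2 + c)"
    using assms by (intro real_less_rsqrt) simp
  then show ?thesis
    by (simp add: gamma_fun_ereal)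
qed

lemma gamma_fun_nonneg:
  assumes "0 \<le> t" "N \<ge> 2"
  shows "0 \<le> gamma_fun N t"
proof -
  have "gamma_fun N (ereal 0) = 0"
    unfolding gamma_fun_ereal using assms(2) by simp
  then show ?thesis
    using gamma_fun_mono[of 0 t N] assms(1) by (simp add: zero_ereal_def)
qed

text \<open>
  \<open>s (s + N - 2)\<close> is the inverse function of \<open>\<gamma>\<close>.
\<close>

lemma gamma_fun_le:
  assumes "N \<ge> 2" "0 \<le> s" and r: "r \<le> s * (s + (real N - 2))"
  shows "gamma_fun N (ereal r) \<le> ereal s"
proof -
  have "((real N - 2) / 2)\<^sup>2 + r \<le> (s + (real N - 2) / 2)\<^sup>2"
    using r by (simp add: power2_eq_square algebra_simps)
  then have "sqrt (((real N - 2) / 2)\<^sup>2 + r) \<le> s + (real N - 2) / 2"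
    using assms by (intro real_le_lsqrt) auto
  then show ?thesis by (simp add: gamma_fun_ereal)
qed

text \<open>
  One of the two values of \<open>\<lambda>\<close> is at least \<open>c\<close>, and the other summand is nonnegative. The weight
  \<open>a\<^sub>N powr (- N / 2)\<close> is at most 1, so the same bound serves both cases.
\<close>

lemma nu_AN_pos:
  fixes a :: "'n::{finite,linorder} \<Rightarrow> real"
  assumes N: "CARD('n) \<ge> 3" and a: "\<forall>i. 1 \<le> a i" and t: "\<forall>i. a i \<le> a (Max UNIV)"
  shows "0 < nu_AN a"
proof -
  define t where "t = a (Max UNIV)"
  define s where "s = t powr (- (real CARD('n) / 2))"
  define c where "c = 1 / (t * (384 * 2 ^ CARD('n)))"
  let ?\<gamma> = "gamma_fun CARD('n)"
  have t1: "1 \<le> t" using a by (simp add: t_def)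
  have s: "0 < s" "s \<le> 1"
    using t1 powr_mono[of "- (real CARD('n) / 2)" 0 t] by (auto simp: s_def)
  have c: "0 < c"
    using t1 by (simp add: c_def)
  have c_le: "c \<le> 1 / (1 * (384 * 2 ^ CARD('n)))"
    unfolding c_def using t1 by (intro divide_left_mono mult_right_mono) auto
  obtain \<delta> where \<delta>: "?\<gamma> (ereal c) = ereal \<delta>" "0 < \<delta>"
    using gamma_fun_pos[OF c, of "CARD('n)"] N by (simp add: gamma_fun_ereal)
  have bound: "ereal (s * \<delta>) \<le> ereal s * ?\<gamma> (lambda_sphere (diag_matrix a) u) + ?\<gamma> (lambda_sphere (mat 1) v)"
    if uv: "u \<in> H1_sphere" "v \<in> H1_sphere"
      "(\<integral>\<^sup>+ \<xi>. ennreal ((u \<xi>)\<^sup>2 * (v \<xi>)\<^sup>2) \<partial>(sphere_measure :: (real, 'n) vec measure)) = 0" for u v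
  proof -
    have \<gamma>u: "0 \<le> ?\<gamma> (lambda_sphere (diag_matrix a) u)"
      using N by (intro gamma_fun_nonneg lambda_sphere_nonneg[OF a]) auto
    have "0 \<le> lambda_sphere (diag_matrix (\<lambda>_::'n. 1)) v"
      by (rule lambda_sphere_nonneg) simp
    then have \<gamma>v: "0 \<le> ?\<gamma> (lambda_sphere (mat 1) v)"
      using N by (intro gamma_fun_nonneg) (auto simp: diag_matrix_one)
    from uv show ?thesis
    proof (cases rule: zero_set_covers_half_sphere)
      case 1
      have "ereal c \<le> lambda_sphere (diag_matrix a) u"
        unfolding c_def using t by (intro lambda_sphere_ge[OF N a _ 1]) (simp add: t_def)
      then have "ereal \<delta> \<le> ?\<gamma> (lambda_sphere (diag_matrix a) u)"
        using gamma_fun_mono[of "ereal c" _ "CARD('n)"] c \<delta>(1) by simp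
      then have "ereal s * ereal \<delta> \<le> ereal s * ?\<gamma> (lambda_sphere (diag_matrix a) u)"
        using s by (intro ereal_mult_left_mono) auto
      also have "\<dots> \<le> \<dots> + ?\<gamma> (lambda_sphere (mat 1) v)"
        using add_left_mono[OF \<gamma>v] by simp
      finally show ?thesis by simp
    next
      case 2
      have "ereal (1 / (1 * (384 * 2 ^ CARD('n)))) \<le> lambda_sphere (diag_matrix (\<lambda>_::'n. 1)) v"
        by (intro lambda_sphere_ge[OF N _ _ 2]) simp_all
      then have "ereal c \<le> lambda_sphere (mat 1) v"
        using c_le by (metis diag_matrix_one ereal_less_eq(3) order_trans)
      then have "ereal \<delta> \<le> ?\<gamma> (lambda_sphere (mat 1) v)"
        using gamma_fun_mono[of "ereal c" _ "CARD('n)"] c \<delta>(1) by simp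
      moreover have "ereal (s * \<delta>) \<le> ereal \<delta>"
        using s \<delta> by (simp add: mult_le_cancel_right1)
      moreover have "0 \<le> ereal s * ?\<gamma> (lambda_sphere (diag_matrix a) u)"
        using s \<gamma>u by simp
      ultimately show ?thesis
        by (metis add.left_neutral add_mono order_trans)
    qed
  qed
  have "ereal (s * \<delta>) \<le> nu_AN a"
    unfolding nu_AN_def using bound by (auto intro!: Inf_greatest simp: s_def t_def)
  moreover have "0 < ereal (s * \<delta>)"
    using s \<delta> by simp
  ultimately show ?thesis by (rule less_le_trans[rotated])
qed

text \<open>
  The competitors live on the two half spheres on either side of the equator orthogonal to the
  \<open>i\<close>-th axis. The second summand may equal 1, so the strict inequality must come from the first one,
  where \<open>a\<^sub>N > 1\<close> enters through \<open>a\<^sub>N + 1 / a\<^sub>N > 2\<close>.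
\<close>

lemma nu_AN_less_2:
  fixes a :: "'n::{finite,linorder} \<Rightarrow> real"
  assumes N: "CARD('n) \<ge> 3" and a: "\<forall>i. 1 \<le> a i" and t: "\<forall>i. a i \<le> a (Max UNIV)"
    and ai: "a i = 1" and gt: "1 < a (Max UNIV)"
  shows "nu_AN a < 2"
proof -
  define t where "t = a (Max UNIV)"
  define r where "r = t powr (real CARD('n) / 2)"
  define u v :: "(real, 'n) vec \<Rightarrow> real"
    where "u = (\<lambda>\<xi>. max (axis i 1 \<bullet> \<xi>) 0)" and "v = (\<lambda>\<xi>. max (- axis i 1 \<bullet> \<xi>) 0)"
  let ?\<gamma> = "gamma_fun CARD('n)"
  have t1: "1 < t" using gt by (simp add: t_def)
  have r2: "r * r = t powr real CARD('n)"
    by (simp add: r_def powr_add[symmetric])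
  have "t powr 1 \<le> t powr real CARD('n)"
    using t1 N by (intro powr_mono) auto
  then have t_le: "t \<le> r * r" using t1 r2 by simp
  have r1: "1 < r"
    using t1 N by (simp add: r_def gr_one_powr)
  have uv: "u \<in> H1_sphere" "v \<in> H1_sphere"
    unfolding u_def v_def H1_sphere_def using has_sphere_gradient_pos_part[of "axis i 1"]
      has_sphere_gradient_pos_part[of "- axis i 1"] by auto
  have "(u \<xi>)\<^sup>2 * (v \<xi>)\<^sup>2 = 0" for \<xi>
    by (auto simp: u_def v_def max_def)
  then have int0: "(\<integral>\<^sup>+ \<xi>. ennreal ((u \<xi>)\<^sup>2 * (v \<xi>)\<^sup>2) \<partial>(sphere_measure :: (real, 'n) vec measure)) = 0"
    by (simp only: ennreal_0 nn_integral_const mult_zero_left)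
  have lam_v: "lambda_sphere (mat 1) v \<le> ereal (real CARD('n) - 1 / 1)"
    unfolding v_def diag_matrix_one[symmetric] by (rule lambda_sphere_pos_part_le[of _ i]) auto
  have lam_u: "lambda_sphere (diag_matrix a) u \<le> ereal (real CARD('n) - 1 / t)"
    unfolding u_def using a t ai by (intro lambda_sphere_pos_part_le[of _ i]) (auto simp: t_def)
  have "0 \<le> lambda_sphere (diag_matrix (\<lambda>_::'n. 1)) v"
    by (rule lambda_sphere_nonneg) simp
  then have "?\<gamma> (lambda_sphere (mat 1) v) \<le> ?\<gamma> (ereal (real CARD('n) - 1 / 1))"
    by (intro gamma_fun_mono lam_v) (simp add: diag_matrix_one)
  also have "\<dots> \<le> ereal 1"
    using N by (intro gamma_fun_le) auto
  finally have \<gamma>v: "?\<gamma> (lambda_sphere (mat 1) v) \<le> ereal 1" .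
  define \<theta> where "\<theta> = sqrt (((real CARD('n) - 2) / 2)\<^sup>2 + (real CARD('n) - 1 / t)) - (real CARD('n) - 2) / 2"
  have "real CARD('n) - 1 / t < r * (r + (real CARD('n) - 2))"
  proof -
    have "2 < t + 1 / t"
    proof -
      have "0 < (t - 1)\<^sup>2 / t" using t1 by simp
      also have "(t - 1)\<^sup>2 / t = t + 1 / t - 2" using t1 by (simp add: power2_eq_square field_simps)
      finally show ?thesis by simp
    qed
    moreover have "1 * (real CARD('n) - 2) \<le> r * (real CARD('n) - 2)"
      using r1 N by (intro mult_right_mono) auto
    ultimately show ?thesis
      using t_le by (simp add: distrib_left)
  qed
  then have "((real CARD('n) - 2) / 2)\<^sup>2 + (real CARD('n) - 1 / t) < (r + (real CARD('n) - 2) / 2)\<^sup>2"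
    by (simp add: power2_eq_square algebra_simps)
  then have "\<theta> < r"
    using real_less_lsqrt[of "r + (real CARD('n) - 2) / 2"] r1 N unfolding \<theta>_def by fastforce
  have "?\<gamma> (lambda_sphere (diag_matrix a) u) \<le> ?\<gamma> (ereal (real CARD('n) - 1 / t))"
    by (intro gamma_fun_mono lam_u lambda_sphere_nonneg[OF a])
  then have \<gamma>u: "?\<gamma> (lambda_sphere (diag_matrix a) u) \<le> ereal \<theta>"
    by (simp add: gamma_fun_ereal \<theta>_def)
  have inv: "t powr (- (real CARD('n) / 2)) = 1 / r"
    by (simp add: r_def powr_minus_divide)
  have "ereal (1 / r) * ?\<gamma> (lambda_sphere (diag_matrix a) u) + ?\<gamma> (lambda_sphere (mat 1) v)
      \<le> ereal (1 / r) * ereal \<theta> + ereal 1"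
    using r1 by (intro add_mono \<gamma>v ereal_mult_left_mono \<gamma>u) auto
  also have "\<dots> < 2"
    using \<open>\<theta> < r\<close> r1 by (simp add: one_ereal_def[symmetric] divide_less_eq)
  finally have less: "ereal (1 / r) * ?\<gamma> (lambda_sphere (diag_matrix a) u) + ?\<gamma> (lambda_sphere (mat 1) v) < 2" .
  have "nu_AN a \<le> ereal (1 / r) * ?\<gamma> (lambda_sphere (diag_matrix a) u) + ?\<gamma> (lambda_sphere (mat 1) v)"
    unfolding nu_AN_def t_def[symmetric] inv using uv int0 by (intro Inf_lower) blast
  with less show ?thesis by (rule le_less_trans[rotated])
qed

theorem lemma2p4:
  fixes a :: "'n::{finite,linorder} \<Rightarrow> real"
  assumes "CARD('n) \<ge> 3"
    and "mono a"
    and "a (Min UNIV) = 1"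
    and "diag_matrix a \<noteq> mat 1"
  shows "0 < nu_AN a \<and> nu_AN a < 2"
proof -
  have lower: "\<forall>i. 1 \<le> a i"
    using monoD[OF assms(2), of "Min UNIV"] assms(3) by (metis Min_le UNIV_I finite)
  have upper: "\<forall>i. a i \<le> a (Max UNIV)"
    using monoD[OF assms(2)] by simp
  have "\<exists>i. a i \<noteq> 1"
    using assms(4) diag_matrix_one by (metis ext)
  then have "1 < a (Max UNIV)"
    using lower upper by (metis less_le order_less_le_trans)
  then show ?thesis
    using nu_AN_pos[OF assms(1) lower upper] nu_AN_less_2[OF assms(1) lower upper assms(3)] by blast
qed

end
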